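(* Let $Z=(Z_n)_{n\in\mathbb N}$, $Z_n\in\mathbb R^{m_*}$, be independent centred random vectors with $\|Z_{n,i}\|_{L^3}\le M_3(Z)$ for all $n,i$ (some $M_3(Z)\ge1$), and let $G=(G_n)_{n\in\mathbb N}$, $G_n\in\mathbb R^{m_*}$, be independent centred Gaussian vectors with $\mathbb E(G_{n,i}G_{n,j})=\mathbb E(Z_{n,i}Z_{n,j})$ for all $n,i,j$; let $M_3(G)\ge1$ with $\|G_{n,i}\|_{L^3}\le M_3(G)$. Let $c$ be a finitely supported family of real coefficients and $N\in\mathbb N$. Then for every $f\in C_b^3(\mathbb R)$, $$|\mathbb E f(S_N(c,Z))-\mathbb E f(S_N(c,G))|\le \mathcal K_{N,m_*}(Z)\,\|f\|_{3,\infty}\,|c|^2\,\delta_*(c),$$ where $\mathcal K_{N,m_*}(Z)=\frac{2m_*}{3}(M_3^3(Z)+M_3^3(G))\,\overline M_3^{\,3N}$ with $\overline M_3=b_3\sqrt{m_*}\,(M_3(Z)\vee M_3(G))$.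
   Context: Multi-indices: for $m\ge0$, a multi-index of length $|\alpha|=m$ is $\alpha=(\alpha_1,\dots,\alpha_m)$ with $\alpha_i=(\alpha_i',\alpha_i'')\in\mathbb N\times[m_*]$ and $\alpha_1'<\dots<\alpha_m'$; $\emptyset$ has length $0$. $x^\alpha=\prod_i x_{\alpha_i',\alpha_i''}$, $x^\emptyset=1$. For real coefficients $c(\alpha)$ (finitely many nonzero), $S_N(c,x)=\sum_{0\le|\alpha|\le N}c(\alpha)x^\alpha$, $|c|^2=\sum_{|\alpha|\le N}c(\alpha)^2$, and the influence factor is $\delta_*(c)=\big(\sup_n\sum_{\alpha:\,n\in\{\alpha_1',\dots,\alpha_{|\alpha|}'\}}c(\alpha)^2\big)^{1/2}$. $\|f\|_{3,\infty}$ is the sup of $|f|,|f'|,|f''|,|f'''|$. $b_3\ge1$ is the constant in Burkholder's inequality in $L^3$ for real martingales. *)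

theory Defs
  imports "HOL-Probability.Probability"
begin

definition multiidx :: "nat \<Rightarrow> (nat \<times> nat) list set" where
  "multiidx m = {\<alpha>. sorted_wrt (\<lambda>p q. fst p < fst q) \<alpha> \<and> (\<forall>p\<in>set \<alpha>. snd p \<in> {1..m})}"

definition xpow :: "(nat \<Rightarrow> nat \<Rightarrow> real) \<Rightarrow> (nat \<times> nat) list \<Rightarrow> real" where
  "xpow x \<alpha> = prod_list (map (\<lambda>(n, i). x n i) \<alpha>)"

text \<open>Finitely many c(alpha) are nonzero, so these sums are finite.\<close>
definition SN :: "nat \<Rightarrow> nat \<Rightarrow> ((nat \<times> nat) list \<Rightarrow> real) \<Rightarrow> (nat \<Rightarrow> nat \<Rightarrow> real) \<Rightarrow> real" where
  "SN m N c x = (\<Sum>\<alpha>\<in>{\<alpha>\<in>multiidx m. length \<alpha> \<le> N \<and> c \<alpha> \<noteq> 0}. c \<alpha> * xpow x \<alpha>)"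

definition coeff_norm_sq :: "nat \<Rightarrow> nat \<Rightarrow> ((nat \<times> nat) list \<Rightarrow> real) \<Rightarrow> real" where
  "coeff_norm_sq m N c = (\<Sum>\<alpha>\<in>{\<alpha>\<in>multiidx m. length \<alpha> \<le> N \<and> c \<alpha> \<noteq> 0}. (c \<alpha>)\<^sup>2)"

definition influence :: "nat \<Rightarrow> ((nat \<times> nat) list \<Rightarrow> real) \<Rightarrow> real" where
  "influence m c = sqrt (SUP n. (\<Sum>\<alpha>\<in>{\<alpha>\<in>multiidx m. n \<in> fst ` set \<alpha> \<and> c \<alpha> \<noteq> 0}. (c \<alpha>)\<^sup>2))"

definition Cb3 :: "(real \<Rightarrow> real) \<Rightarrow> bool" where
  "Cb3 f \<longleftrightarrow> (\<forall>k<3. \<forall>x. ((deriv ^^ k) f has_real_derivative (deriv ^^ Suc k) f x) (at x))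
     \<and> continuous_on UNIV ((deriv ^^ 3) f)
     \<and> (\<forall>k\<le>3. bounded (range ((deriv ^^ k) f)))"

definition norm3 :: "(real \<Rightarrow> real) \<Rightarrow> real" where
  "norm3 f = Max ((\<lambda>k. SUP x. \<bar>(deriv ^^ k) f x\<bar>) ` {0..3})"

definition centred_gaussian_vec :: "'a measure \<Rightarrow> nat set \<Rightarrow> (nat \<Rightarrow> 'a \<Rightarrow> real) \<Rightarrow> bool" where
  "centred_gaussian_vec M I X \<longleftrightarrow> (\<forall>i\<in>I. X i \<in> borel_measurable M) \<and>
     (\<forall>a. (AE \<omega> in M. (\<Sum>i\<in>I. a i * X i \<omega>) = 0) \<or>
          (\<exists>\<sigma>>0. distributed M lborel (\<lambda>\<omega>. \<Sum>i\<in>I. a i * X i \<omega>) (normal_density 0 \<sigma>)))"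

definition burkholder3 :: "'a measure \<Rightarrow> real \<Rightarrow> bool" where
  "burkholder3 M b \<longleftrightarrow> (\<forall>(F::nat \<Rightarrow> 'a measure) (X::nat \<Rightarrow> 'a \<Rightarrow> real) n.
     (\<forall>k. subalgebra M (F k)) \<and> (\<forall>k. sets (F k) \<subseteq> sets (F (Suc k))) \<and>
     (\<forall>k. X k \<in> borel_measurable (F k)) \<and> (\<forall>k. integrable M (\<lambda>\<omega>. \<bar>X k \<omega>\<bar> ^ 3)) \<and>
     (\<forall>k. AE \<omega> in M. real_cond_exp M (F k) (X (Suc k)) \<omega> = X k \<omega>)
     \<longrightarrow> (\<integral>\<omega>. \<bar>X n \<omega>\<bar> ^ 3 \<partial>M)
         \<le> b ^ 3 * (\<integral>\<omega>. ((X 0 \<omega>)\<^sup>2 + (\<Sum>k<n. (X (Suc k) \<omega> - X k \<omega>)\<^sup>2)) powr (3/2) \<partial>M))"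

end

theory Submission
  imports Defs
begin

text \<open>Lindeberg's method: the blocks of Z are replaced by those of G one at a time. Since the
  polynomial is affine in each block and first and second moments agree, every replacement costs
  only a third-order Taylor remainder, governed by the third moments of the partial derivatives.
  On the product of the laws these are bounded by Fubini's theorem, one block after the other, by
  means of E|X + D|^3 <= (A^2 + 9/4 e^2)^(3/2), where A and e bound the L3 norms of X and of the
  martingale increment D. This yields the hypercontractive constant 3/2 per degree, without
  needing Burkholder's inequality for the mixed (Z, G) sequences. The Burkholder hypothesis enters
  only through a lower bound: a nondegenerate Gaussian makes M' rich enough to carry a martingale
  forcing b3^3 >= 29/8, and this surplus over (3/2)^3 absorbs the number N of replacements that
  affect a monomial. If all Gaussians vanish, then so do all Z, and both sides are constant.\<close>

section \<open>A lower bound for the Burkholder constant\<close>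

text \<open>The obstacle is the hybrid sequences: they mix blocks from \<open>M\<close> and
  \<open>M'\<close>, while each Burkholder hypothesis speaks about one space. Moreover, on a
  one-point space that inequality holds with constant 1, below the 3/2 per degree obtained here;
  hence a lower bound must be extracted from the randomness that a Gaussian puts on
  \<open>M'\<close>. The value 29/8 comes from the bookkeeping. A replacement costs 1/6 times two
  third moments, where the claim allows 2m/3: a spare factor 4m. Partial derivatives have degree N -
  1, where the claim has exponent 3N: a spare factor (b3 sqrt(m) Q)^3, Q being the larger moment
  bound. Its part m^(3/2) Q^3 pays for the m derivatives in one block. What is left is to bound N
  (27/8)^(N-1) by 4 b3^(3N). If b3^3 >= 27/8 + h, Bernoulli's inequality makes the right side at
  least 4 h N (27/8)^(N-1), so h = 1/4 is enough. Any martingale with Burkholder ratio above 29/8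
  will then do; the one used has rational values, so that the ratio can be checked by exact
  arithmetic.\<close>

lemma (in prob_space) distributed_lborel_quantile:
  fixes g :: "'a \<Rightarrow> real"
  assumes g: "distributed M lborel g f" and q: "0 < q" "q < 1"
  shows "\<exists>t. prob {\<omega>\<in>space M. g \<omega> \<le> t} = q"
proof -
  have gm[measurable]: "g \<in> borel_measurable M" using g by (auto simp: distributed_def)
  have fm[measurable]: "f \<in> borel_measurable lborel" using g by (auto simp: distributed_def)
  interpret D: real_distribution "distr M borel g" by (rule real_distribution_distr) simp
  have cdf: "cdf (distr M borel g) t = prob {\<omega>\<in>space M. g \<omega> \<le> t}" for t
    by (simp add: cdf_def measure_distr) (auto intro!: arg_cong[where f=prob])
  \<comment> \<open>A law with a density charges no point, so its distribution function is
    continuous and takes every value in (0, 1).\<close>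
  have "isCont (cdf (distr M borel g)) x" for x
  proof -
    have "emeasure (distr M borel g) {x} = emeasure (distr M lborel g) {x}"
      by (simp add: emeasure_distr)
    also have "\<dots> = emeasure (density lborel f) {x}"
      using distributed_distr_eq_density[OF g] by simp
    also have "\<dots> = 0"
      by (subst emeasure_density) (auto simp: nn_integral_0_iff_AE AE_lborel_singleton intro!: AE_I'[of "{x}"] split: split_indicator)
    finally show ?thesis by (simp add: D.isCont_cdf measure_def)
  qed
  moreover obtain a where "cdf (distr M borel g) a < q"
  proof -
    have "eventually (\<lambda>t. cdf (distr M borel g) t < q) at_bot"
      using order_tendstoD(2)[OF D.cdf_lim_at_bot q(1)] .
    then show ?thesis using that by (auto simp: eventually_at_bot_linorder)
  qed
  moreover obtain b where "cdf (distr M borel g) b > q"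
  proof -
    have "eventually (\<lambda>t. q < cdf (distr M borel g) t) at_top"
      using order_tendstoD(1)[OF D.cdf_lim_at_top_prob q(2)] .
    then show ?thesis using that by (auto simp: eventually_at_top_linorder)
  qed
  moreover have "a \<le> b"
    using D.cdf_nondecreasing[of b a] calculation(2,3) by linarith
  ultimately have "\<exists>t\<ge>a. t \<le> b \<and> cdf (distr M borel g) t = q"
    by (intro IVT) auto
  then show ?thesis by (auto simp: cdf)
qed

text \<open>A truncated geometric time is read off a single variable: sublevel sets at decreasing
  levels are nested with halving probabilities, and counting those that contain the outcome gives
  the tails (1/2)^k. No independent coin tosses are constructed.\<close>

lemma (in prob_space) geometric_time_exists:
  fixes g :: "'a \<Rightarrow> real" and N :: nat
  assumes gm[measurable]: "g \<in> borel_measurable M"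
    and quantile: "\<And>q. 0 < q \<Longrightarrow> q < 1 \<Longrightarrow> \<exists>t. prob {\<omega>\<in>space M. g \<omega> \<le> t} = q"
  obtains \<tau> :: "'a \<Rightarrow> nat"
  where "\<tau> \<in> measurable M (count_space UNIV)" "\<And>\<omega>. \<tau> \<omega> \<le> N"
    "\<And>k. k \<le> N \<Longrightarrow> prob {\<omega>\<in>space M. k \<le> \<tau> \<omega>} = (1/2)^k"
proof -
  have "\<exists>t. prob {\<omega>\<in>space M. g \<omega> \<le> t} = (1/2)^Suc k" for k
    by (rule quantile) (simp_all add: power_less_one_iff del: power_Suc)
  then obtain t where t: "\<And>k. prob {\<omega>\<in>space M. g \<omega> \<le> t k} = (1/2)^Suc k" by metis
  have "t (Suc k) \<le> t k" for k
  proof (rule ccontr)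
    assume "\<not> t (Suc k) \<le> t k"
    then have "prob {\<omega>\<in>space M. g \<omega> \<le> t k} \<le> prob {\<omega>\<in>space M. g \<omega> \<le> t (Suc k)}"
      by (intro finite_measure_mono) auto
    then show False unfolding t by simp
  qed
  then have anti: "antimono t" by (simp add: decseq_Suc_iff)
  define \<tau> where "\<tau> \<omega> = card {k. k < N \<and> g \<omega> \<le> t k}" for \<omega>
  have \<tau>_sum: "\<tau> \<omega> = (\<Sum>k<N. if g \<omega> \<le> t k then 1 else 0)" for \<omega>
    unfolding \<tau>_def by (subst sum.inter_filter[symmetric]) (simp_all add: lessThan_def)
  have \<tau>_ge: "Suc k \<le> \<tau> \<omega> \<longleftrightarrow> g \<omega> \<le> t k" if "k < N" for k \<omega>
  proof
    assume "g \<omega> \<le> t k"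
    then have "{..k} \<subseteq> {k. k < N \<and> g \<omega> \<le> t k}"
      using that anti by (auto dest: antimonoD intro: order_trans)
    from card_mono[OF _ this] show "Suc k \<le> \<tau> \<omega>" by (simp add: \<tau>_def)
  next
    assume k: "Suc k \<le> \<tau> \<omega>"
    show "g \<omega> \<le> t k"
    proof (rule ccontr)
      assume "\<not> g \<omega> \<le> t k"
      then have "{k. k < N \<and> g \<omega> \<le> t k} \<subseteq> {..<k}"
        using anti by (force simp: not_le[symmetric] dest: antimonoD intro: order_trans)
      from card_mono[OF _ this] k show False by (simp add: \<tau>_def)
    qed
  qed
  show ?thesis
  proof
    show "\<tau> \<in> measurable M (count_space UNIV)" unfolding \<tau>_sum by measurable
    show "\<tau> \<omega> \<le> N" for \<omega>
      unfolding \<tau>_def using card_mono[of "{..<N}" "{k. k < N \<and> g \<omega> \<le> t k}"] by auto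
    show "prob {\<omega>\<in>space M. k \<le> \<tau> \<omega>} = (1/2)^k" if "k \<le> N" for k
      using that by (cases k) (simp_all add: \<tau>_ge t prob_space)
  qed
qed

text \<open>The arithmetic-geometric mean inequality for sqrt s, sharp at v = sqrt s. For rational s
  and v the bound is rational, which permits exact evaluation.\<close>

lemma powr_three_halves_le:
  fixes s v :: real
  assumes "0 \<le> s" "0 < v"
  shows "s powr (3/2) \<le> (s\<^sup>2 / v + s * v) / 2"
proof -
  have "s powr (3/2) = s * sqrt s"
    using assms powr_add[of s 1 "1/2"] by (simp add: powr_half_sqrt)
  also have "sqrt s \<le> (s / v + v) / 2"
    using arith_geo_mean_sqrt[of "s/v" v] assms by simp
  finally have "s powr (3/2) \<le> s * ((s / v + v) / 2)" 
    using assms by (simp add: mult_left_mono)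
  then show ?thesis by (simp add: power2_eq_square algebra_simps)
qed

text \<open>The test martingale starts at 1 and is multiplied by 7/5 or 3/5 with equal probability, being
  stopped at the first downward step; after 16 steps the ratio of the two sides of Burkholder's
  inequality is about 3.9. The event algebra at time n consists of the events that do not split
  the set where the martingale is still running.\<close>

lemma burkholder3_lower_bound:
  fixes M :: "'a measure" and g :: "'a \<Rightarrow> real"
  assumes PM: "prob_space M" and g: "distributed M lborel g f" and B: "burkholder3 M b"
  shows "29 / 8 \<le> b ^ 3"
proof -
  interpret prob_space M by fact
  \<comment> \<open>The third moment carried by the running paths grows by (7/5)^3 / 2 > 1 per step,
    so the starting value 1 gradually loses its weight in the ratio; 16 steps are enough.\<close>
  define N :: nat where "N = 16"
  have gm: "g \<in> borel_measurable M" using g by (auto simp: distributed_def)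
  obtain \<tau> :: "'a \<Rightarrow> nat" where \<tau>m[measurable]: "\<tau> \<in> measurable M (count_space UNIV)"
    and \<tau>N: "\<And>\<omega>. \<tau> \<omega> \<le> N"
    and \<tau>p: "\<And>k. k \<le> N \<Longrightarrow> prob {\<omega>\<in>space M. k \<le> \<tau> \<omega>} = (1/2)^k"
    using geometric_time_exists[OF gm distributed_lborel_quantile[OF g]] by metis
  have \<tau>ge: "prob {\<omega>\<in>space M. Suc k \<le> \<tau> \<omega>} = (1/2)^Suc k" if "k < N" for k
    using \<tau>p[of "Suc k"] that by simp
  have \<tau>eq: "prob {\<omega>\<in>space M. \<tau> \<omega> = k} = (1/2)^Suc k" if "k < N" for k
  proof -
    have "prob {\<omega>\<in>space M. \<tau> \<omega> = k} = prob ({\<omega>\<in>space M. k \<le> \<tau> \<omega>} - {\<omega>\<in>space M. Suc k \<le> \<tau> \<omega>})"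
      by (rule arg_cong[where f=prob]) auto
    also have "\<dots> = (1/2)^k - (1/2)^Suc k"
      using that by (subst finite_measure_Diff) (auto simp: \<tau>p \<tau>ge)
    finally show ?thesis by simp
  qed
  have \<tau>last: "prob {\<omega>\<in>space M. \<tau> \<omega> = N} = (1/2)^N"
  proof -
    have "{\<omega>\<in>space M. \<tau> \<omega> = N} = {\<omega>\<in>space M. N \<le> \<tau> \<omega>}"
      using \<tau>N by (auto intro: antisym)
    then show ?thesis by (simp add: \<tau>p)
  qed
  have intg: "integrable M (\<lambda>\<omega>. y (\<tau> \<omega>))" for y :: "nat \<Rightarrow> real"
  proof (rule integrable_const_bound[where B="\<Sum>k\<le>N. \<bar>y k\<bar>"])
    show "AE \<omega> in M. norm (y (\<tau> \<omega>)) \<le> (\<Sum>k\<le>N. \<bar>y k\<bar>)"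
      using \<tau>N by (auto intro!: AE_I2 member_le_sum[of _ _ "\<lambda>k. \<bar>y k\<bar>"])
  qed measurable
  have expect: "(\<integral>\<omega>. y (\<tau> \<omega>) \<partial>M) = (\<Sum>k<N. (1/2)^Suc k * y k) + (1/2)^N * y N" for y :: "nat \<Rightarrow> real"
  proof -
    have "(\<integral>\<omega>. y (\<tau> \<omega>) \<partial>M) = (\<integral>\<omega>. (\<Sum>k\<le>N. y k * indicator {\<omega>\<in>space M. \<tau> \<omega> = k} \<omega>) \<partial>M)"
      using \<tau>N by (intro Bochner_Integration.integral_cong) (auto simp: indicator_def of_bool_def if_distrib[of "\<lambda>z. _ * z"] cong: if_cong)
    also have "\<dots> = (\<Sum>k\<le>N. y k * prob {\<omega>\<in>space M. \<tau> \<omega> = k})"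
      by (subst Bochner_Integration.integral_sum) (auto simp: integrable_mult_left integrable_real_indicator less_top[symmetric])
    also have "\<dots> = (\<Sum>k<N. y k * prob {\<omega>\<in>space M. \<tau> \<omega> = k}) + y N * prob {\<omega>\<in>space M. \<tau> \<omega> = N}"
      by (simp add: lessThan_Suc_atMost[symmetric])
    finally show ?thesis by (simp add: \<tau>eq \<tau>last mult.commute)
  qed
  \<comment> \<open>Here \<open>j\<close> is the number of upward steps. \<open>min n N\<close>
    freezes the process after time \<open>N\<close>, as \<open>burkholder3\<close> asks for a
    martingale over all times.\<close>
  define xv :: "nat \<Rightarrow> nat \<Rightarrow> real"
    where "xv n j = (if min n N \<le> j then (7/5)^min n N else (3/5) * (7/5)^j)" for n j
  define X where "X n \<omega> = xv n (\<tau> \<omega>)" for n \<omega>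
  define F where "F n = sigma (space M) {B\<in>sets M. {\<omega>\<in>space M. n \<le> \<tau> \<omega>} \<subseteq> B \<or> {\<omega>\<in>space M. n \<le> \<tau> \<omega>} \<inter> B = {}}" for n
  have sigF: "sigma_algebra (space M) {B\<in>sets M. {\<omega>\<in>space M. n \<le> \<tau> \<omega>} \<subseteq> B \<or> {\<omega>\<in>space M. n \<le> \<tau> \<omega>} \<inter> B = {}}" for n
    by (auto simp: sigma_algebra_iff2 dest: sets.sets_into_space)
  have setsF: "sets (F n) = {B\<in>sets M. {\<omega>\<in>space M. n \<le> \<tau> \<omega>} \<subseteq> B \<or> {\<omega>\<in>space M. n \<le> \<tau> \<omega>} \<inter> B = {}}" for n
    unfolding F_def by (rule sigma_algebra.sets_measure_of_eq[OF sigF])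
  have spaceF: "space (F n) = space M" for n
    unfolding F_def by (rule space_measure_of) (auto dest: sets.sets_into_space)
  have subF: "subalgebra M (F n)" for n by (auto simp: subalgebra_def spaceF setsF)
  have incF: "sets (F k) \<subseteq> sets (F (Suc k))" for k
  proof -
    have "{\<omega>\<in>space M. Suc k \<le> \<tau> \<omega>} \<subseteq> {\<omega>\<in>space M. k \<le> \<tau> \<omega>}" by auto
    then show ?thesis unfolding setsF by blast
  qed
  have XF: "X n \<in> borel_measurable (F n)" for n
  proof (rule measurableI)
    fix B :: "real set" assume "B \<in> sets borel"
    have "X n -` B \<inter> space M \<in> sets M" unfolding X_def by measurable
    moreover have "X n \<omega> = (7/5)^min n N" if "n \<le> \<tau> \<omega>" for \<omega>
      using that by (auto simp: X_def xv_def)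
    then have "{\<omega>\<in>space M. n \<le> \<tau> \<omega>} \<subseteq> X n -` B \<inter> space M \<or> {\<omega>\<in>space M. n \<le> \<tau> \<omega>} \<inter> (X n -` B \<inter> space M) = {}"
      by (cases "(7/5)^min n N \<in> B") auto
    ultimately show "X n -` B \<inter> space (F n) \<in> sets (F n)" by (simp add: setsF spaceF)
  qed simp
  have int3: "integrable M (\<lambda>\<omega>. \<bar>X k \<omega>\<bar> ^ 3)" for k
    unfolding X_def by (rule intg)
  have intX: "integrable M (X k)" for k
    unfolding X_def by (rule intg)
  have mart: "AE \<omega> in M. real_cond_exp M (F k) (X (Suc k)) \<omega> = X k \<omega>" for k
  proof -
    interpret finite_measure_subalgebra M "F k" by unfold_locales (rule subF)
    show ?thesis
    proof (rule real_cond_exp_charact)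
      fix B assume BF: "B \<in> sets (F k)"
      then have [measurable]: "B \<in> sets M" by (simp add: setsF)
      have i: "integrable M (\<lambda>\<omega>. indicator B \<omega> * X n \<omega>)" for n
        using integrable_mult_indicator[OF _ intX, of B n] by simp
      have "(\<integral>\<omega>. indicator B \<omega> * (X (Suc k) \<omega> - X k \<omega>) \<partial>M) = 0"
      \<comment> \<open>An event of \<open>F k\<close> either misses the running set, outside which
        the increment vanishes, or contains it; then the increments 2/5 (7/5)^k and -2/5 (7/5)^k
        occur with equal probability. From time \<open>N\<close> on nothing moves.\<close>
      proof (cases "k < N \<and> {\<omega>\<in>space M. k \<le> \<tau> \<omega>} \<subseteq> B")
        case True
        define d where "d j = xv (Suc k) j - xv k j" for j
        have d: "d j = (if j = k then - (2/5) * (7/5)^k else if Suc k \<le> j then (2/5) * (7/5)^k else 0)" for j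
          using True by (auto simp: d_def xv_def)
        have "(\<integral>\<omega>. indicator B \<omega> * (X (Suc k) \<omega> - X k \<omega>) \<partial>M)
          = (\<integral>\<omega>. (2/5) * (7/5)^k * indicator {\<omega>\<in>space M. Suc k \<le> \<tau> \<omega>} \<omega> - (2/5) * (7/5)^k * indicator {\<omega>\<in>space M. \<tau> \<omega> = k} \<omega> \<partial>M)"
        proof (rule Bochner_Integration.integral_cong)
          fix \<omega> assume w: "\<omega> \<in> space M"
          have eq: "X (Suc k) \<omega> - X k \<omega> = d (\<tau> \<omega>)" by (simp add: X_def d_def)
          have inB: "\<omega> \<in> B" if "k \<le> \<tau> \<omega>" using that w True by auto
          show "indicator B \<omega> * (X (Suc k) \<omega> - X k \<omega>) = (2/5) * (7/5)^k * indicator {\<omega>\<in>space M. Suc k \<le> \<tau> \<omega>} \<omega> - (2/5) * (7/5)^k * indicator {\<omega>\<in>space M. \<tau> \<omega> = k} \<omega>"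
            unfolding eq d using inB w by (auto simp: indicator_def)
        qed simp
        also have "\<dots> = (2/5) * (7/5)^k * prob {\<omega>\<in>space M. Suc k \<le> \<tau> \<omega>} - (2/5) * (7/5)^k * prob {\<omega>\<in>space M. \<tau> \<omega> = k}"
          by (subst Bochner_Integration.integral_diff) (auto simp: less_top[symmetric])
        also have "\<dots> = 0" using True \<tau>ge[of k] \<tau>eq[of k] by simp
        finally show ?thesis .
      next
        case False
        have zero: "indicator B \<omega> * (X (Suc k) \<omega> - X k \<omega>) = 0" if "\<omega> \<in> space M" for \<omega>
        proof (cases "k < N \<and> k \<le> \<tau> \<omega>")
          case True
          then have "\<omega> \<notin> B" using False BF that by (auto simp: setsF)
          then show ?thesis by simp
        next
          case False then show ?thesis using \<tau>N[of \<omega>] by (auto simp: X_def xv_def min_def not_less)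
        qed
        have "(\<integral>\<omega>. indicator B \<omega> * (X (Suc k) \<omega> - X k \<omega>) \<partial>M) = (\<integral>\<omega>. 0 \<partial>M)"
          by (rule Bochner_Integration.integral_cong[OF refl zero])
        then show ?thesis by simp
      qed
      then show "(\<integral>x\<in>B. X (Suc k) x \<partial>M) = (\<integral>x\<in>B. X k x \<partial>M)"
        using Bochner_Integration.integral_diff[OF i[of "Suc k"] i[of k]]
        by (simp add: set_lebesgue_integral_def right_diff_distrib)
    qed (rule intX XF)+
  qed
  have main: "(\<integral>\<omega>. \<bar>X N \<omega>\<bar> ^ 3 \<partial>M) \<le> b ^ 3 * (\<integral>\<omega>. ((X 0 \<omega>)\<^sup>2 + (\<Sum>k<N. (X (Suc k) \<omega> - X k \<omega>)\<^sup>2)) powr (3/2) \<partial>M)"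
    using B unfolding burkholder3_def using subF incF XF int3 mart by blast
  have lhs: "(\<integral>\<omega>. \<bar>X N \<omega>\<bar> ^ 3 \<partial>M) = (\<Sum>k<N. (1/2)^Suc k * (3/5 * (7/5)^k)^3) + (1/2)^N * ((7/5)^N)^3"
    unfolding X_def by (subst expect) (simp add: xv_def)
  \<comment> \<open>\<open>s j\<close> is the square function after \<open>j\<close> moves: up or
    down, move k has the square 4/25 (49/25)^k. \<open>v j\<close> is a rational stand-in for sqrt
    (s j), which is close to (7/5)^j / sqrt 6.\<close>
  define s where "s j = 1 + (\<Sum>k<j. (4/25) * ((7/5)^k)\<^sup>2 :: real)" for j
  define v :: "nat \<Rightarrow> real" where "v j = (2/5) * (7/5)^j" for j
  \<comment> \<open>The downward step is a move too, so j upward steps yield j + 1 squares, except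
    at time \<open>N\<close>, where no downward step has occurred.\<close>
  define j' where "j' j = min (Suc j) N" for j
  have sq: "(X 0 \<omega>)\<^sup>2 + (\<Sum>k<N. (X (Suc k) \<omega> - X k \<omega>)\<^sup>2) = s (j' (\<tau> \<omega>))" for \<omega>
  proof -
    have "(\<Sum>k<N. (X (Suc k) \<omega> - X k \<omega>)\<^sup>2) = (\<Sum>k<N. if k < j' (\<tau> \<omega>) then (4/25) * ((7/5)^k)\<^sup>2 else 0)"
    proof (rule sum.cong[OF refl])
      fix k assume "k \<in> {..<N}"
      then show "(X (Suc k) \<omega> - X k \<omega>)\<^sup>2 = (if k < j' (\<tau> \<omega>) then (4/25) * ((7/5)^k)\<^sup>2 else 0)"
        by (cases k "\<tau> \<omega>" rule: linorder_cases)
          (auto simp: X_def xv_def j'_def power2_eq_square algebra_simps)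
    qed
    also have "\<dots> = (\<Sum>k<j' (\<tau> \<omega>). (4/25) * ((7/5)^k)\<^sup>2)"
      by (rule sum.mono_neutral_cong_right) (auto simp: j'_def)
    finally show ?thesis by (simp add: s_def X_def xv_def)
  qed
  define t where "t j = ((s j)\<^sup>2 / v j + s j * v j) / 2" for j
  have s0: "0 \<le> s j" for j unfolding s_def by (intro add_nonneg_nonneg sum_nonneg) auto
  have st: "s j powr (3/2) \<le> t j" for j
    unfolding t_def by (rule powr_three_halves_le[OF s0]) (simp add: v_def)
  have rhs: "(\<integral>\<omega>. ((X 0 \<omega>)\<^sup>2 + (\<Sum>k<N. (X (Suc k) \<omega> - X k \<omega>)\<^sup>2)) powr (3/2) \<partial>M)
    \<le> (\<Sum>k<N. (1/2)^Suc k * t (Suc k)) + (1/2)^N * t N"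
  proof -
    have "(\<integral>\<omega>. s (j' (\<tau> \<omega>)) powr (3/2) \<partial>M) \<le> (\<integral>\<omega>. t (j' (\<tau> \<omega>)) \<partial>M)"
      by (rule integral_mono[OF intg[of "\<lambda>j. s (j' j) powr (3/2)"] intg[of "\<lambda>j. t (j' j)"]]) (rule st)
    also have "\<dots> = (\<Sum>k<N. (1/2)^Suc k * t (Suc k)) + (1/2)^N * t N"
      using expect[of "\<lambda>j. t (j' j)"] by (simp add: j'_def)
    finally show ?thesis by (simp add: sq)
  qed
  have numeric: "29/8 * ((\<Sum>k<N. (1/2)^Suc k * t (Suc k)) + (1/2)^N * t N) \<le> (\<Sum>k<N. (1/2)^Suc k * (3/5 * (7/5)^k)^3) + (1/2)^N * ((7/5)^N)^3"
  proof -
    \<comment> \<open>A geometric sum, with 1/6 = (4/25) / (49/25 - 1). It turns the claim into a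
      comparison of explicit rationals.\<close>
    have s_closed: "s j = (5 + ((7/5)^j)\<^sup>2) / 6" for j
    proof (induction j)
      case (Suc j)
      have "s (Suc j) = s j + (4/25) * ((7/5)^j)\<^sup>2" by (simp add: s_def)
      also have "\<dots> = (5 + 49/25 * ((7/5)^j)\<^sup>2) / 6" unfolding Suc.IH by (simp add: field_simps)
      also have "49/25 * ((7/5)^j)\<^sup>2 = ((7/5)^Suc j :: real)\<^sup>2" by (simp add: power2_eq_square)
      finally show ?case .
    qed (simp add: s_def)
    have sum16: "(\<Sum>k<16. h k) = h 0 + h 1 + h 2 + h 3 + h 4 + h 5 + h 6 + h 7 + h 8 + h 9 + h 10
        + h 11 + h 12 + h 13 + h 14 + h 15" for h :: "nat \<Rightarrow> real"
      by (simp add: numeral_eq_Suc)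
    show ?thesis
      unfolding N_def sum16 t_def s_closed v_def by (simp add: power_divide)
  qed
  let ?I = "\<integral>\<omega>. ((X 0 \<omega>)\<^sup>2 + (\<Sum>k<N. (X (Suc k) \<omega> - X k \<omega>)\<^sup>2)) powr (3/2) \<partial>M"
  have nn: "0 \<le> ?I" by (rule integral_nonneg_AE) simp
  have pos: "0 < (\<integral>\<omega>. \<bar>X N \<omega>\<bar> ^ 3 \<partial>M)" unfolding lhs
    by (rule add_nonneg_pos) (auto intro!: sum_nonneg)
  show ?thesis
  proof (rule ccontr)
    assume neg: "\<not> 29 / 8 \<le> b ^ 3"
    have "?I \<noteq> 0" using pos main by auto
    then have Ipos: "0 < ?I" by (intro le_neq_trans[OF nn]) simp
    have "b ^ 3 * ?I < 29/8 * ?I" using neg Ipos by (intro mult_strict_right_mono) auto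
    also have "\<dots> \<le> 29/8 * ((\<Sum>k<N. (1/2)^Suc k * t (Suc k)) + (1/2)^N * t N)"
      using rhs by simp
    finally show False using numeric main lhs by linarith
  qed
qed

section \<open>Third moments\<close>

text \<open>This is the Taylor expansion of |x|^3 with the cubic term made absolute. Its linear term
  has mean zero once d is a centred increment.\<close>

lemma abs_add_cube_le:
  fixes x d :: real
  shows "\<bar>x + d\<bar> ^ 3 \<le> \<bar>x\<bar> ^ 3 + 3 * x * \<bar>x\<bar> * d + 3 * \<bar>x\<bar> * d\<^sup>2 + \<bar>d\<bar> ^ 3"
proof -
  have nonneg: "\<bar>x + d\<bar> ^ 3 \<le> \<bar>x\<bar> ^ 3 + 3 * x * \<bar>x\<bar> * d + 3 * \<bar>x\<bar> * d\<^sup>2 + \<bar>d\<bar> ^ 3"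
    if x: "0 \<le> x" for x d :: real
  proof (cases "0 \<le> x + d")
    case True
    have "(x + d) ^ 3 = x ^ 3 + 3 * x * x * d + 3 * x * d\<^sup>2 + d ^ 3"
      by (simp add: power2_eq_square power3_eq_cube algebra_simps)
    moreover have "d ^ 3 \<le> \<bar>d\<bar> ^ 3" by (simp add: power_abs[symmetric])
    ultimately show ?thesis using True x by simp
  next
    case False
    \<comment> \<open>When x + d is negative, the two sides of the claim differ by half of this
      expression.\<close>
    have "0 \<le> x * (x\<^sup>2 + 3 * (x + 2 * d)\<^sup>2)" using x by simp
    then have "0 \<le> 2 * x ^ 3 + 6 * x * x * d + 6 * x * d\<^sup>2"
      by (simp add: power2_eq_square power3_eq_cube algebra_simps)
    moreover have "\<bar>x + d\<bar> ^ 3 = - (x ^ 3 + 3 * x * x * d + 3 * x * d\<^sup>2 + d ^ 3)"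
      using False by (simp add: power2_eq_square power3_eq_cube algebra_simps)
    moreover have "\<bar>d\<bar> ^ 3 = - (d ^ 3)" using False x by simp
    ultimately show ?thesis using x by (simp add: algebra_simps)
  qed
  show ?thesis
  proof (cases "0 \<le> x")
    case True then show ?thesis by (rule nonneg)
  next
    case False
    have "\<bar>x + d\<bar> = \<bar>- x + - d\<bar>" by linarith
    then show ?thesis using nonneg[of "- x" "- d"] False by simp
  qed
qed

text \<open>Jensen's inequality for the cube with weights t: the tangent at the weighted mean c lies
  below, as r^3 - 3 c^2 r + 2 c^3 = (r - c)^2 (r + 2c).\<close>

lemma sum_mult_cube_le:
  fixes t y :: "'i \<Rightarrow> real"
  assumes t: "\<And>i. i \<in> I \<Longrightarrow> 0 \<le> t i" and y: "\<And>i. i \<in> I \<Longrightarrow> 0 \<le> y i"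
  shows "(\<Sum>i\<in>I. t i * y i) ^ 3 \<le> (\<Sum>i\<in>I. t i)\<^sup>2 * (\<Sum>i\<in>I. t i * y i ^ 3)"
proof (cases "(\<Sum>i\<in>I. t i) = 0")
  case True
  show ?thesis
  proof (cases "finite I")
    case fin: True
    then have "t i = 0" if "i \<in> I" for i using True t that by (simp add: sum_nonneg_eq_0_iff)
    then show ?thesis by simp
  qed simp
next
  case False
  define T where "T = (\<Sum>i\<in>I. t i)"
  have T: "0 < T" using False t sum_nonneg[of I t] by (simp add: T_def order_less_le)
  define c where "c = (\<Sum>i\<in>I. t i * y i) / T"
  have c: "0 \<le> c" unfolding c_def using T t y by (intro divide_nonneg_pos sum_nonneg) auto
  have "3 * c\<^sup>2 * r - 2 * c ^ 3 \<le> r ^ 3" if "0 \<le> r" for r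
  proof -
    have "0 \<le> (r - c)\<^sup>2 * (r + 2 * c)" using that c by simp
    then show ?thesis by (simp add: power2_eq_square power3_eq_cube algebra_simps)
  qed
  then have "(\<Sum>i\<in>I. t i * (3 * c\<^sup>2 * y i - 2 * c ^ 3)) \<le> (\<Sum>i\<in>I. t i * y i ^ 3)"
    using t y by (intro sum_mono mult_left_mono) auto
  also have "(\<Sum>i\<in>I. t i * (3 * c\<^sup>2 * y i - 2 * c ^ 3)) = 3 * c\<^sup>2 * (\<Sum>i\<in>I. t i * y i) - 2 * c ^ 3 * T"
    by (simp add: T_def right_diff_distrib sum_subtractf sum_distrib_left sum_distrib_right mult_ac)
  also have "(\<Sum>i\<in>I. t i * y i) = T * c" using T by (simp add: c_def)
  also have "3 * c\<^sup>2 * (T * c) - 2 * c ^ 3 * T = T * c ^ 3"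
    by (simp add: power2_eq_square power3_eq_cube algebra_simps)
  finally have "T\<^sup>2 * (T * c ^ 3) \<le> T\<^sup>2 * (\<Sum>i\<in>I. t i * y i ^ 3)" by (intro mult_left_mono) auto
  moreover have "T\<^sup>2 * (T * c ^ 3) = (\<Sum>i\<in>I. t i * y i) ^ 3"
    using T by (simp add: c_def power2_eq_square power3_eq_cube)
  ultimately show ?thesis by (simp add: T_def)
qed

text \<open>Young's inequality 3 p q^2 <= p^3 + 2 q^3 at p = u/A and q = w/e. If A and e bound the
  L3 norms of u and w, integration yields Hoelder's bound A e^2.\<close>

lemma mult_square_le_cubes:
  fixes u w A e :: real
  assumes "0 \<le> u" "0 \<le> w" "0 < A" "0 < e"
  shows "u * w\<^sup>2 \<le> A * e\<^sup>2 * (u ^ 3 / (3 * A ^ 3) + 2 * w ^ 3 / (3 * e ^ 3))"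
proof -
  have "3 * p * q\<^sup>2 \<le> p ^ 3 + 2 * q ^ 3" if "0 \<le> p" "0 \<le> q" for p q :: real
  proof -
    have "0 \<le> (p - q)\<^sup>2 * (p + 2 * q)" using that by simp
    then show ?thesis by (simp add: power2_eq_square power3_eq_cube algebra_simps)
  qed
  from this[of "u / A" "w / e"] assms have "3 * (u / A) * (w / e)\<^sup>2 \<le> (u / A) ^ 3 + 2 * (w / e) ^ 3"
    by simp
  then have "A * e\<^sup>2 * (3 * (u / A) * (w / e)\<^sup>2) \<le> A * e\<^sup>2 * ((u / A) ^ 3 + 2 * (w / e) ^ 3)"
    using assms by (intro mult_left_mono) auto
  then show ?thesis using assms by (simp add: power_divide field_simps)
qed

text \<open>After squaring, a coefficient 2 in place of 9/4 would cancel the A^4 e^2 terms and leave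
  -2 A^3 e^3 dominant for small e. The choice 9/4 leaves 3/4 A^4 e^2, and it is the square of the
  constant 3/2 per degree.\<close>

lemma cubic_le_sqrt_cube:
  fixes A e :: real
  assumes "0 \<le> A" "0 \<le> e"
  shows "A ^ 3 + 3 * A * e\<^sup>2 + e ^ 3 \<le> sqrt (A\<^sup>2 + 9/4 * e\<^sup>2) ^ 3"
proof -
  \<comment> \<open>The negative terms -2 A^3 e^3 and -6 A e^5 are completed to squares, at the
    expense of 4/3 + 4 out of the coefficient 99/16 of A^2 e^4 and of 9/4 out of the coefficient
    665/64 of e^6.\<close>
  have quad: "0 \<le> (3/4 * A\<^sup>2 - 2 * A * e + 4/3 * e\<^sup>2) * A\<^sup>2"
  proof -
    have "3/4 * A\<^sup>2 - 2 * A * e + 4/3 * e\<^sup>2 = 3/4 * (A - 4/3 * e)\<^sup>2"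
      by (simp add: power2_eq_square algebra_simps)
    then show ?thesis by (simp only:) (intro mult_nonneg_nonneg, auto)
  qed
  have quad2: "0 \<le> (4 * A\<^sup>2 - 6 * A * e + 9/4 * e\<^sup>2) * e\<^sup>2"
  proof -
    have "4 * A\<^sup>2 - 6 * A * e + 9/4 * e\<^sup>2 = (2 * A - 3/2 * e)\<^sup>2"
      by (simp add: power2_eq_square algebra_simps)
    then show ?thesis by (simp only: mult_nonneg_nonneg zero_le_power2)
  qed
  have "(A\<^sup>2 + 9/4 * e\<^sup>2) ^ 3 - (A ^ 3 + 3 * A * e\<^sup>2 + e ^ 3)\<^sup>2
     = e\<^sup>2 * ((3/4 * A\<^sup>2 - 2 * A * e + 4/3 * e\<^sup>2) * A\<^sup>2 + (4 * A\<^sup>2 - 6 * A * e + 9/4 * e\<^sup>2) * e\<^sup>2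
         + (99/16 - 4/3 - 4) * A\<^sup>2 * e\<^sup>2 + (665/64 - 9/4) * (e\<^sup>2 * e\<^sup>2))"
    by (simp add: power2_eq_square power3_eq_cube field_simps)
  also have "\<dots> \<ge> 0" by (intro mult_nonneg_nonneg[OF zero_le_power2] add_nonneg_nonneg[OF add_nonneg_nonneg[OF add_nonneg_nonneg[OF quad quad2]]]) auto
  finally have "(A ^ 3 + 3 * A * e\<^sup>2 + e ^ 3)\<^sup>2 \<le> (A\<^sup>2 + 9/4 * e\<^sup>2) ^ 3" by simp
  then have "A ^ 3 + 3 * A * e\<^sup>2 + e ^ 3 \<le> sqrt ((A\<^sup>2 + 9/4 * e\<^sup>2) ^ 3)"
    by (rule real_le_rsqrt)
  then show ?thesis by (simp add: real_sqrt_power)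
qed

text \<open>Norm bounds act as denominators below and may be zero; they are enlarged by a positive
  amount, which is removed here.\<close>

lemma le_limit_at_zero:
  fixes g :: "real \<Rightarrow> real"
  assumes "\<And>\<epsilon>. 0 < \<epsilon> \<Longrightarrow> c \<le> g \<epsilon>" and "continuous (at_right 0) g"
  shows "c \<le> g 0"
proof (rule tendsto_lowerbound)
  show "(g \<longlongrightarrow> g 0) (at_right 0)" using assms(2) by (simp add: continuous_within)
  show "eventually (\<lambda>\<epsilon>. c \<le> g \<epsilon>) (at_right 0)"
    using assms(1) by (auto simp: eventually_at_right_field intro: exI[of _ 1])
qed simp

text \<open>\<open>B\<close> bounds the L3 norm, with cubes in place of roots. Integrability is
  included because the integral of a non-integrable function is 0 by convention.\<close>

definition cube_int :: "'a measure \<Rightarrow> ('a \<Rightarrow> real) \<Rightarrow> real \<Rightarrow> bool" where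
  "cube_int M g B \<longleftrightarrow> 0 \<le> B \<and> g \<in> borel_measurable M \<and> integrable M (\<lambda>x. \<bar>g x\<bar> ^ 3) \<and>
     (\<integral>x. \<bar>g x\<bar> ^ 3 \<partial>M) \<le> B ^ 3"

text \<open>Minkowski's inequality in L3: Jensen's inequality with weights B i, applied to the
  functions |g i| / B i of norm at most 1. Vanishing bounds force the detour through B i +
  \<epsilon>.\<close>

lemma cube_int_sum:
  assumes I: "finite I" and g: "\<And>i. i \<in> I \<Longrightarrow> cube_int M (g i) (B i)"
  shows "cube_int M (\<lambda>x. \<Sum>i\<in>I. \<bar>g i x\<bar>) (\<Sum>i\<in>I. B i)"
proof -
  have [measurable]: "g i \<in> borel_measurable M" if "i \<in> I" for i
    using g[OF that] by (simp add: cube_int_def)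
  have gi: "integrable M (\<lambda>x. \<bar>g i x\<bar> ^ 3)" if "i \<in> I" for i
    using g[OF that] by (simp add: cube_int_def)
  have B: "0 \<le> B i" "(\<integral>x. \<bar>g i x\<bar> ^ 3 \<partial>M) \<le> B i ^ 3" if "i \<in> I" for i
    using g[OF that] by (simp_all add: cube_int_def)
  have bnd: "(\<Sum>i\<in>I. \<bar>g i x\<bar>) ^ 3 \<le> (\<Sum>i\<in>I. B i + \<epsilon>)\<^sup>2 * (\<Sum>i\<in>I. \<bar>g i x\<bar> ^ 3 / (B i + \<epsilon>)\<^sup>2)"
    if "0 < \<epsilon>" for \<epsilon> x
  proof -
    have nz: "B i + \<epsilon> \<noteq> 0" "0 \<le> B i + \<epsilon>" if "i \<in> I" for i using B(1)[OF that] \<open>0 < \<epsilon>\<close> by auto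
    have "(\<Sum>i\<in>I. (B i + \<epsilon>) * (\<bar>g i x\<bar> / (B i + \<epsilon>))) ^ 3
      \<le> (\<Sum>i\<in>I. B i + \<epsilon>)\<^sup>2 * (\<Sum>i\<in>I. (B i + \<epsilon>) * (\<bar>g i x\<bar> / (B i + \<epsilon>)) ^ 3)"
      using nz by (intro sum_mult_cube_le) auto
    moreover have "(\<Sum>i\<in>I. (B i + \<epsilon>) * (\<bar>g i x\<bar> / (B i + \<epsilon>))) = (\<Sum>i\<in>I. \<bar>g i x\<bar>)"
      using nz by (intro sum.cong) auto
    moreover have "(\<Sum>i\<in>I. (B i + \<epsilon>) * (\<bar>g i x\<bar> / (B i + \<epsilon>)) ^ 3) = (\<Sum>i\<in>I. \<bar>g i x\<bar> ^ 3 / (B i + \<epsilon>)\<^sup>2)"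
      using nz by (intro sum.cong) (auto simp: power2_eq_square power3_eq_cube)
    ultimately show ?thesis by simp
  qed
  have int: "integrable M (\<lambda>x. (\<Sum>i\<in>I. B i + \<epsilon>)\<^sup>2 * (\<Sum>i\<in>I. \<bar>g i x\<bar> ^ 3 / (B i + \<epsilon>)\<^sup>2))" for \<epsilon>
    using gi by (intro integrable_mult_right Bochner_Integration.integrable_sum integrable_divide) auto
  have sum_nn: "0 \<le> (\<Sum>i\<in>I. \<bar>g i x\<bar>)" for x by (intro sum_nonneg) auto
  have int3: "integrable M (\<lambda>x. (\<Sum>i\<in>I. \<bar>g i x\<bar>) ^ 3)"
    by (rule Bochner_Integration.integrable_bound[OF int[of 1]])
       (use bnd[of 1] sum_nn in \<open>auto intro!: AE_I2 order_trans[OF _ abs_ge_self]\<close>)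
  have "(\<integral>x. (\<Sum>i\<in>I. \<bar>g i x\<bar>) ^ 3 \<partial>M) \<le> (\<Sum>i\<in>I. B i + \<epsilon>) ^ 3" if \<epsilon>: "0 < \<epsilon>" for \<epsilon>
  proof -
    have "(\<integral>x. (\<Sum>i\<in>I. \<bar>g i x\<bar>) ^ 3 \<partial>M) \<le> (\<integral>x. (\<Sum>i\<in>I. B i + \<epsilon>)\<^sup>2 * (\<Sum>i\<in>I. \<bar>g i x\<bar> ^ 3 / (B i + \<epsilon>)\<^sup>2) \<partial>M)"
      by (rule integral_mono[OF int3 int bnd[OF \<epsilon>]])
    also have "\<dots> = (\<Sum>i\<in>I. B i + \<epsilon>)\<^sup>2 * (\<Sum>i\<in>I. (\<integral>x. \<bar>g i x\<bar> ^ 3 \<partial>M) / (B i + \<epsilon>)\<^sup>2)"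
      using gi by (simp add: Bochner_Integration.integral_sum)
    also have "\<dots> \<le> (\<Sum>i\<in>I. B i + \<epsilon>)\<^sup>2 * (\<Sum>i\<in>I. B i + \<epsilon>)"
    proof (intro mult_left_mono sum_mono)
      fix i assume i: "i \<in> I"
      have "(\<integral>x. \<bar>g i x\<bar> ^ 3 \<partial>M) \<le> (B i + \<epsilon>) ^ 3"
        using B[OF i] \<epsilon> by (meson less_eq_real_def order_trans power_mono le_add_same_cancel1)
      then show "(\<integral>x. \<bar>g i x\<bar> ^ 3 \<partial>M) / (B i + \<epsilon>)\<^sup>2 \<le> B i + \<epsilon>"
        using B(1)[OF i] \<epsilon> by (subst pos_divide_le_eq) (simp_all add: power2_eq_square power3_eq_cube mult.assoc)
    qed simp
    finally show ?thesis by (simp add: power2_eq_square power3_eq_cube)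
  qed
  then have "(\<integral>x. (\<Sum>i\<in>I. \<bar>g i x\<bar>) ^ 3 \<partial>M) \<le> (\<Sum>i\<in>I. B i + 0) ^ 3"
    by (rule le_limit_at_zero) (auto intro!: continuous_intros)
  then show ?thesis
    using int3 sum_nn B(1) unfolding cube_int_def by (auto intro: sum_nonneg)
qed

text \<open>The 2-uniform smoothness of the third moment: W dominates the increment of a martingale
  started at U. The optimal constant is 2; the value 9/4 has an elementary proof.\<close>

lemma cube_int_smoothness:
  assumes U: "cube_int M U A" and W: "cube_int M W e" and W0: "\<And>x. 0 \<le> W x"
  shows "integrable M (\<lambda>x. \<bar>U x\<bar> ^ 3 + 3 * \<bar>U x\<bar> * (W x)\<^sup>2 + W x ^ 3)"
    and "(\<integral>x. \<bar>U x\<bar> ^ 3 + 3 * \<bar>U x\<bar> * (W x)\<^sup>2 + W x ^ 3 \<partial>M) \<le> sqrt (A\<^sup>2 + 9/4 * e\<^sup>2) ^ 3"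
proof -
  have [measurable]: "U \<in> borel_measurable M" "W \<in> borel_measurable M"
    using U W by (auto simp: cube_int_def)
  have A: "0 \<le> A" "0 \<le> e" using U W by (auto simp: cube_int_def)
  have iU: "integrable M (\<lambda>x. \<bar>U x\<bar> ^ 3)" and iW: "integrable M (\<lambda>x. W x ^ 3)"
    and bU: "(\<integral>x. \<bar>U x\<bar> ^ 3 \<partial>M) \<le> A ^ 3" and bW: "(\<integral>x. W x ^ 3 \<partial>M) \<le> e ^ 3"
    using U W W0 by (simp_all add: cube_int_def)
  have bnd: "\<bar>U x\<bar> * (W x)\<^sup>2 \<le> a * b\<^sup>2 * (\<bar>U x\<bar> ^ 3 / (3 * a ^ 3) + 2 * W x ^ 3 / (3 * b ^ 3))"
    if "0 < a" "0 < b" for a b x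
    using mult_square_le_cubes[of "\<bar>U x\<bar>" "W x" a b] W0 that by simp
  have int: "integrable M (\<lambda>x. a * b\<^sup>2 * (\<bar>U x\<bar> ^ 3 / (3 * a ^ 3) + 2 * W x ^ 3 / (3 * b ^ 3)))" for a b
    using iU iW by (intro integrable_mult_right Bochner_Integration.integrable_add integrable_divide) auto
  have iUW: "integrable M (\<lambda>x. \<bar>U x\<bar> * (W x)\<^sup>2)"
    by (rule Bochner_Integration.integrable_bound[OF int[of 1 1]])
       (use bnd[of 1 1] in \<open>auto intro!: AE_I2 order_trans[OF _ abs_ge_self] simp: abs_mult\<close>)
  have i3: "integrable M (\<lambda>x. 3 * \<bar>U x\<bar> * (W x)\<^sup>2)"
    using integrable_mult_right[OF iUW, of 3] by (simp add: mult.assoc)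
  show "integrable M (\<lambda>x. \<bar>U x\<bar> ^ 3 + 3 * \<bar>U x\<bar> * (W x)\<^sup>2 + W x ^ 3)"
    using iU iW i3 by auto
  \<comment> \<open>Hoelder's inequality by way of Young's; \<open>a\<close> and \<open>b\<close>
    are positive majorants, because \<open>A\<close> or \<open>e\<close> can be 0.\<close>
  have "(\<integral>x. \<bar>U x\<bar> * (W x)\<^sup>2 \<partial>M) \<le> a * b\<^sup>2" if ab: "0 < a" "0 < b" "A \<le> a" "e \<le> b" for a b
  proof -
    have "(\<integral>x. \<bar>U x\<bar> * (W x)\<^sup>2 \<partial>M) \<le> (\<integral>x. a * b\<^sup>2 * (\<bar>U x\<bar> ^ 3 / (3 * a ^ 3) + 2 * W x ^ 3 / (3 * b ^ 3)) \<partial>M)"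
      by (rule integral_mono[OF iUW int bnd[OF ab(1,2)]])
    also have "\<dots> = a * b\<^sup>2 * ((\<integral>x. \<bar>U x\<bar> ^ 3 \<partial>M) / (3 * a ^ 3) + 2 * (\<integral>x. W x ^ 3 \<partial>M) / (3 * b ^ 3))"
      using iU iW by simp
    also have "\<dots> \<le> a * b\<^sup>2 * (a ^ 3 / (3 * a ^ 3) + 2 * b ^ 3 / (3 * b ^ 3))"
    proof (intro mult_left_mono add_mono divide_right_mono)
      show "(\<integral>x. \<bar>U x\<bar> ^ 3 \<partial>M) \<le> a ^ 3" using bU power_mono[OF ab(3) A(1), of 3] by simp
      show "(\<integral>x. W x ^ 3 \<partial>M) \<le> b ^ 3" using bW power_mono[OF ab(4) A(2), of 3] by simp
    qed (use ab in auto)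
    also have "\<dots> = a * b\<^sup>2" using ab by (simp add: field_simps)
    finally show ?thesis .
  qed
  then have "(\<integral>x. \<bar>U x\<bar> * (W x)\<^sup>2 \<partial>M) \<le> (A + \<epsilon>) * (e + \<epsilon>)\<^sup>2" if "0 < \<epsilon>" for \<epsilon>
    using that A by simp
  then have "(\<integral>x. \<bar>U x\<bar> * (W x)\<^sup>2 \<partial>M) \<le> (A + 0) * (e + 0)\<^sup>2"
    by (rule le_limit_at_zero) (auto intro!: continuous_intros)
  then have "(\<integral>x. 3 * \<bar>U x\<bar> * (W x)\<^sup>2 \<partial>M) \<le> 3 * A * e\<^sup>2"
    using integral_mult_right_zero[of M 3 "\<lambda>x. \<bar>U x\<bar> * (W x)\<^sup>2"] by (simp add: mult.assoc)
  then have "(\<integral>x. \<bar>U x\<bar> ^ 3 + 3 * \<bar>U x\<bar> * (W x)\<^sup>2 + W x ^ 3 \<partial>M) \<le> A ^ 3 + 3 * A * e\<^sup>2 + e ^ 3"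
    using iU iW i3 bU bW by simp
  also have "\<dots> \<le> sqrt (A\<^sup>2 + 9/4 * e\<^sup>2) ^ 3" by (rule cubic_le_sqrt_cube[OF A])
  finally show "(\<integral>x. \<bar>U x\<bar> ^ 3 + 3 * \<bar>U x\<bar> * (W x)\<^sup>2 + W x ^ 3 \<partial>M) \<le> sqrt (A\<^sup>2 + 9/4 * e\<^sup>2) ^ 3" .
qed

section \<open>Multilinear polynomials in independent blocks\<close>

text \<open>Monomials are sets of variables under an abstract index: taking a partial derivative
  then only shrinks the index set and the sets \<open>A j\<close>, while the coefficients keep their
  indices.\<close>

definition mlpoly :: "'j set \<Rightarrow> ('j \<Rightarrow> real) \<Rightarrow> ('j \<Rightarrow> (nat \<times> nat) set) \<Rightarrow> (nat \<Rightarrow> nat \<Rightarrow> real) \<Rightarrow> real" where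
  "mlpoly J a A x = (\<Sum>j\<in>J. a j * (\<Prod>p\<in>A j. x (fst p) (snd p)))"

text \<open>Injectivity of A takes the place of the orthogonality of distinct monomials, and injectivity
  of fst makes each monomial affine in every block of coordinates.\<close>

definition admissible :: "nat set \<Rightarrow> nat \<Rightarrow> 'j set \<Rightarrow> ('j \<Rightarrow> (nat \<times> nat) set) \<Rightarrow> bool" where
  "admissible I m J A \<longleftrightarrow> finite J \<and> inj_on A J \<and> (\<forall>j\<in>J. finite (A j) \<and> A j \<subseteq> I \<times> {1..m} \<and> inj_on fst (A j))"

lemma admissible_rest:
  assumes "admissible (insert n I) m J A"
  shows "admissible I m {j\<in>J. n \<notin> fst ` A j} A"
  unfolding admissible_def
proof (intro conjI ballI)
  show "finite {j\<in>J. n \<notin> fst ` A j}" using assms by (simp add: admissible_def)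
  show "inj_on A {j\<in>J. n \<notin> fst ` A j}"
    using assms by (auto simp: admissible_def intro: inj_on_subset)
  fix j assume "j \<in> {j\<in>J. n \<notin> fst ` A j}"
  then have j: "finite (A j)" "A j \<subseteq> insert n I \<times> {1..m}" "inj_on fst (A j)" "n \<notin> fst ` A j"
    using assms by (simp_all add: admissible_def)
  show "finite (A j)" "inj_on fst (A j)" by fact+
  show "A j \<subseteq> I \<times> {1..m}" using j(2,4) by (fastforce simp: image_iff)
qed

text \<open>These are the monomials of the partial derivative in the variable (n, i). Reinserting
  that variable recovers \<open>A j\<close>, so distinct indices keep distinct monomials; by
  injectivity of \<open>fst\<close> no other variable of block n remains.\<close>

lemma admissible_slice:
  assumes "admissible (insert n I) m J A"
  shows "admissible I m {j\<in>J. (n, i) \<in> A j} (\<lambda>j. A j - {(n, i)})"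
  unfolding admissible_def
proof (intro conjI ballI)
  show "finite {j \<in> J. (n, i) \<in> A j}" using assms by (auto simp: admissible_def)
  have inj: "inj_on A J" using assms by (auto simp: admissible_def)
  show "inj_on (\<lambda>j. A j - {(n, i)}) {j \<in> J. (n, i) \<in> A j}"
  proof (rule inj_onI)
    fix j k assume jk: "j \<in> {j \<in> J. (n, i) \<in> A j}" "k \<in> {j \<in> J. (n, i) \<in> A j}"
      and "A j - {(n, i)} = A k - {(n, i)}"
    then have "insert (n, i) (A j - {(n, i)}) = insert (n, i) (A k - {(n, i)})" by simp
    then have "A j = A k" using jk by (simp add: insert_absorb)
    then show "j = k" using inj jk by (auto dest: inj_onD)
  qed
  fix j assume j: "j \<in> {j \<in> J. (n, i) \<in> A j}"
  then have A: "finite (A j)" "A j \<subseteq> insert n I \<times> {1..m}" "inj_on fst (A j)" "(n, i) \<in> A j"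
    using assms by (auto simp: admissible_def)
  show "finite (A j - {(n, i)})" "inj_on fst (A j - {(n, i)})"
    using A by (auto intro: inj_on_subset)
  show "A j - {(n, i)} \<subseteq> I \<times> {1..m}"
  proof
    fix p assume p: "p \<in> A j - {(n, i)}"
    then have "fst p \<noteq> n" using A(3,4) by (metis DiffE fst_conv inj_onD insertI1)
    then show "p \<in> I \<times> {1..m}" using A(2) p by auto
  qed
qed

text \<open>A monomial that meets block n contains exactly one of its variables. The polynomial is
  therefore affine in z, with the partial derivatives as coefficients.\<close>

lemma mlpoly_split:
  assumes A: "admissible (insert n I) m J A"
  shows "mlpoly J a A (x(n := z)) = mlpoly {j\<in>J. n \<notin> fst ` A j} a A x +
    (\<Sum>i=1..m. z i * mlpoly {j\<in>J. (n, i) \<in> A j} a (\<lambda>j. A j - {(n, i)}) x)"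
proof -
  have J: "finite J" using A by (simp add: admissible_def)
  define P where "P j y = a j * (\<Prod>p\<in>A j. y (fst p) (snd p))" for j and y :: "nat \<Rightarrow> nat \<Rightarrow> real"
  have rest: "P j (x(n := z)) = P j x" if "n \<notin> fst ` A j" for j
    using that unfolding P_def by (intro arg_cong2[where f="(*)"] prod.cong) (auto simp: image_iff)
  have slice: "P j (x(n := z)) = (\<Sum>i=1..m. if (n, i) \<in> A j then z i * (a j * (\<Prod>p\<in>A j - {(n, i)}. x (fst p) (snd p))) else 0)"
    if j: "j \<in> J" "n \<in> fst ` A j" for j
  proof -
    have Aj: "finite (A j)" "A j \<subseteq> insert n I \<times> {1..m}" "inj_on fst (A j)"
      using A j by (auto simp: admissible_def)
    obtain i where i: "(n, i) \<in> A j" using j by auto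
    have im: "i \<in> {1..m}" using i Aj by auto
    have uniq: "(n, i') \<in> A j \<longleftrightarrow> i' = i" for i'
      using i inj_onD[OF Aj(3), of "(n, i')" "(n, i)"] by auto
    have "(\<Prod>p\<in>A j. (x(n := z)) (fst p) (snd p)) = z i * (\<Prod>p\<in>A j - {(n, i)}. (x(n := z)) (fst p) (snd p))"
      by (subst prod.remove[OF Aj(1) i]) simp
    also have "(\<Prod>p\<in>A j - {(n, i)}. (x(n := z)) (fst p) (snd p)) = (\<Prod>p\<in>A j - {(n, i)}. x (fst p) (snd p))"
    proof (rule prod.cong[OF refl])
      fix p assume p: "p \<in> A j - {(n, i)}"
      then have "fst p \<noteq> n" using uniq[of "snd p"] by (cases p) auto
      then show "(x(n := z)) (fst p) (snd p) = x (fst p) (snd p)" by simp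
    qed
    finally have "P j (x(n := z)) = z i * (a j * (\<Prod>p\<in>A j - {(n, i)}. x (fst p) (snd p)))"
      by (simp add: P_def)
    then show ?thesis using im by (simp add: uniq)
  qed
  have "mlpoly J a A (x(n := z)) = (\<Sum>j\<in>{j\<in>J. n \<notin> fst ` A j}. P j (x(n := z))) + (\<Sum>j\<in>{j\<in>J. n \<in> fst ` A j}. P j (x(n := z)))"
    unfolding mlpoly_def P_def[symmetric] using J
    by (subst sum.union_disjoint[symmetric]) (auto intro!: sum.cong)
  also have "(\<Sum>j\<in>{j\<in>J. n \<notin> fst ` A j}. P j (x(n := z))) = mlpoly {j\<in>J. n \<notin> fst ` A j} a A x"
    unfolding mlpoly_def P_def[symmetric] by (intro sum.cong) (auto simp: rest)
  also have "(\<Sum>j\<in>{j\<in>J. n \<in> fst ` A j}. P j (x(n := z))) =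
     (\<Sum>j\<in>{j\<in>J. n \<in> fst ` A j}. \<Sum>i=1..m. if (n, i) \<in> A j then z i * (a j * (\<Prod>p\<in>A j - {(n, i)}. x (fst p) (snd p))) else 0)"
    by (intro sum.cong) (auto simp: slice)
  also have "\<dots> = (\<Sum>i=1..m. \<Sum>j\<in>{j\<in>J. n \<in> fst ` A j}. if (n, i) \<in> A j then z i * (a j * (\<Prod>p\<in>A j - {(n, i)}. x (fst p) (snd p))) else 0)"
    by (rule sum.swap)
  also have "\<dots> = (\<Sum>i=1..m. z i * mlpoly {j\<in>J. (n, i) \<in> A j} a (\<lambda>j. A j - {(n, i)}) x)"
  proof (rule sum.cong[OF refl])
    fix i
    have "(\<Sum>j\<in>{j\<in>J. n \<in> fst ` A j}. if (n, i) \<in> A j then z i * (a j * (\<Prod>p\<in>A j - {(n, i)}. x (fst p) (snd p))) else 0)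
      = (\<Sum>j\<in>{j\<in>J. (n, i) \<in> A j}. z i * (a j * (\<Prod>p\<in>A j - {(n, i)}. x (fst p) (snd p))))"
      using J by (intro sum.mono_neutral_cong_right) (auto simp: rev_image_eqI)
    then show "(\<Sum>j\<in>{j\<in>J. n \<in> fst ` A j}. if (n, i) \<in> A j then z i * (a j * (\<Prod>p\<in>A j - {(n, i)}. x (fst p) (snd p))) else 0)
      = z i * mlpoly {j\<in>J. (n, i) \<in> A j} a (\<lambda>j. A j - {(n, i)}) x"
      by (simp add: mlpoly_def sum_distrib_left)
  qed
  finally show ?thesis .
qed

text \<open>The square of the hypercontractive bound: each variable of a monomial costs a factor
  \<open>L\<close>.\<close>

definition weight :: "real \<Rightarrow> 'j set \<Rightarrow> ('j \<Rightarrow> real) \<Rightarrow> ('j \<Rightarrow> (nat \<times> nat) set) \<Rightarrow> real" where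
  "weight L J a A = (\<Sum>j\<in>J. (a j)\<^sup>2 * L ^ card (A j))"

lemma weight_nonneg: "0 \<le> L \<Longrightarrow> 0 \<le> weight L J a A"
  unfolding weight_def by (intro sum_nonneg) auto

text \<open>\<open>weight\<close> is itself an \<open>mlpoly\<close>, with coefficients (a j)^2 and
  every variable set to \<open>L\<close>; the recursion is inherited from
  \<open>mlpoly_split\<close>.\<close>

lemma weight_split:
  assumes A: "admissible (insert n I) m J A"
  shows "weight L J a A = weight L {j\<in>J. n \<notin> fst ` A j} a A +
    L * (\<Sum>i=1..m. weight L {j\<in>J. (n, i) \<in> A j} a (\<lambda>j. A j - {(n, i)}))"
proof -
  have w: "weight L J' a A' = mlpoly J' (\<lambda>j. (a j)\<^sup>2) A' (\<lambda>_ _. L)" for J' A'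
    by (simp add: weight_def mlpoly_def)
  have upd: "(\<lambda>_ _. L) = (\<lambda>_ _. L)(n := \<lambda>_. L)" by auto
  show ?thesis unfolding w
    by (subst (1) upd, subst mlpoly_split[OF A]) (simp add: sum_distrib_left)
qed

section \<open>The law of a single block, and induction over blocks\<close>

definition moment_law :: "nat \<Rightarrow> real \<Rightarrow> (nat \<Rightarrow> real) measure \<Rightarrow> bool" where
  "moment_law m Q P \<longleftrightarrow> prob_space P \<and> 0 < Q \<and> (\<forall>i\<in>{1..m}. cube_int P (\<lambda>z. z i) Q \<and> (\<integral>z. z i \<partial>P) = 0)"

text \<open>Lyapunov's inequality, from Young's inequality with the constant B as first
  factor.\<close>

lemma (in prob_space) cube_int_imp_square:
  assumes g: "cube_int M g B" and B: "0 < B"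
  shows "integrable M (\<lambda>x. (g x)\<^sup>2)" "(\<integral>x. (g x)\<^sup>2 \<partial>M) \<le> B\<^sup>2"
proof -
  have [measurable]: "g \<in> borel_measurable M" and i: "integrable M (\<lambda>x. \<bar>g x\<bar> ^ 3)"
    and le: "(\<integral>x. \<bar>g x\<bar> ^ 3 \<partial>M) \<le> B ^ 3" using g by (auto simp: cube_int_def)
  have bnd: "(g x)\<^sup>2 \<le> B * B\<^sup>2 * (B ^ 3 / (3 * B ^ 3) + 2 * \<bar>g x\<bar> ^ 3 / (3 * B ^ 3)) / B" for x
    using mult_square_le_cubes[of B "\<bar>g x\<bar>" B B] B by (simp add: field_simps)
  have int: "integrable M (\<lambda>x. B * B\<^sup>2 * (B ^ 3 / (3 * B ^ 3) + 2 * \<bar>g x\<bar> ^ 3 / (3 * B ^ 3)) / B)"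
    using i by auto
  show sq: "integrable M (\<lambda>x. (g x)\<^sup>2)"
    by (rule Bochner_Integration.integrable_bound[OF int])
       (use bnd in \<open>auto intro!: AE_I2 order_trans[OF _ abs_ge_self]\<close>)
  have "(\<integral>x. (g x)\<^sup>2 \<partial>M) \<le> (\<integral>x. B * B\<^sup>2 * (B ^ 3 / (3 * B ^ 3) + 2 * \<bar>g x\<bar> ^ 3 / (3 * B ^ 3)) / B \<partial>M)"
    by (rule integral_mono[OF sq int bnd])
  also have "\<dots> = B * B\<^sup>2 * (B ^ 3 / (3 * B ^ 3) + 2 * (\<integral>x. \<bar>g x\<bar> ^ 3 \<partial>M) / (3 * B ^ 3)) / B"
    using i by (simp add: prob_space)
  also have "\<dots> \<le> B * B\<^sup>2 * (B ^ 3 / (3 * B ^ 3) + 2 * B ^ 3 / (3 * B ^ 3)) / B"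
    using B le by (intro divide_right_mono mult_left_mono add_mono) auto
  also have "\<dots> = B\<^sup>2" using B by simp
  finally show "(\<integral>x. (g x)\<^sup>2 \<partial>M) \<le> B\<^sup>2" .
qed

lemma (in prob_space) cube_int_imp_integrable:
  assumes g: "cube_int M g B"
  shows "integrable M g"
proof -
  have [measurable]: "g \<in> borel_measurable M" and i: "integrable M (\<lambda>x. \<bar>g x\<bar> ^ 3)"
    using g by (auto simp: cube_int_def)
  show ?thesis
  proof (rule Bochner_Integration.integrable_bound[of _ "\<lambda>x. 1 + \<bar>g x\<bar> ^ 3"])
    have "\<bar>y\<bar> \<le> 1 + \<bar>y\<bar> ^ 3" for y :: real
    proof (cases "\<bar>y\<bar> \<le> 1")
      case False
      then show ?thesis using self_le_power[of "\<bar>y\<bar>" 3] by simp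
    qed (simp add: add_increasing2)
    then show "AE x in M. norm (g x) \<le> norm (1 + \<bar>g x\<bar> ^ 3)"
      by (auto intro!: AE_I2 order_trans[OF _ abs_ge_self])
  qed (use i in auto)
qed

lemma moment_law_linear:
  fixes v :: "nat \<Rightarrow> real"
  assumes P: "moment_law m Q P"
  defines "D \<equiv> \<lambda>z. \<Sum>i=1..m. z i * v i"
  shows "cube_int P D (Q * (\<Sum>i=1..m. \<bar>v i\<bar>))"
    and "integrable P D" "(\<integral>z. D z \<partial>P) = 0"
    and "integrable P (\<lambda>z. (D z)\<^sup>2)" "(\<integral>z. (D z)\<^sup>2 \<partial>P) \<le> (Q * (\<Sum>i=1..m. \<bar>v i\<bar>))\<^sup>2"
proof -
  interpret prob_space P using P by (simp add: moment_law_def)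
  have Q: "0 < Q" using P by (simp add: moment_law_def)
  have c: "cube_int P (\<lambda>z. z i) Q" if "i \<in> {1..m}" for i using P that by (simp add: moment_law_def)
  have zero: "(\<integral>z. z i \<partial>P) = 0" if "i \<in> {1..m}" for i using P that by (simp add: moment_law_def)
  have m[measurable]: "(\<lambda>z. z i) \<in> borel_measurable P" if "i \<in> {1..m}" for i
    using c[OF that] by (simp add: cube_int_def)
  have D[measurable]: "D \<in> borel_measurable P" unfolding D_def by measurable
  have cv: "cube_int P (\<lambda>z. z i * v i) (Q * \<bar>v i\<bar>)" if i: "i \<in> {1..m}" for i
    using c[OF i] mult_right_mono[of _ "Q ^ 3" "\<bar>v i\<bar> ^ 3"]
    by (auto simp: cube_int_def abs_mult power_mult_distrib)
  from cube_int_sum[OF _ this, of "{1..m}" "\<lambda>i. i"]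
  have cs: "cube_int P (\<lambda>z. \<Sum>i=1..m. \<bar>z i * v i\<bar>) (Q * (\<Sum>i=1..m. \<bar>v i\<bar>))"
    by (simp add: sum_distrib_left)
  have Dle: "\<bar>D z\<bar> ^ 3 \<le> \<bar>\<Sum>i=1..m. \<bar>z i * v i\<bar>\<bar> ^ 3" for z
    unfolding D_def by (intro power_mono order_trans[OF sum_abs abs_ge_self]) auto
  have i3: "integrable P (\<lambda>z. \<bar>D z\<bar> ^ 3)"
    by (rule Bochner_Integration.integrable_bound[of _ "\<lambda>z. \<bar>\<Sum>i=1..m. \<bar>z i * v i\<bar>\<bar> ^ 3"])
       (use cs Dle in \<open>auto simp: cube_int_def\<close>)
  show cD: "cube_int P D (Q * (\<Sum>i=1..m. \<bar>v i\<bar>))"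
    using cs i3 integral_mono[OF i3 _ Dle] by (auto simp: cube_int_def intro: order_trans)
  show "integrable P D" using cD by (rule cube_int_imp_integrable)
  show "(\<integral>z. D z \<partial>P) = 0"
    unfolding D_def using zero cube_int_imp_integrable[OF c]
    by (subst Bochner_Integration.integral_sum) auto
  show "integrable P (\<lambda>z. (D z)\<^sup>2)" "(\<integral>z. (D z)\<^sup>2 \<partial>P) \<le> (Q * (\<Sum>i=1..m. \<bar>v i\<bar>))\<^sup>2"
  proof -
    let ?s = "\<Sum>i=1..m. \<bar>v i\<bar>"
    have "integrable P (\<lambda>z. (D z)\<^sup>2) \<and> (\<integral>z. (D z)\<^sup>2 \<partial>P) \<le> (Q * ?s)\<^sup>2"
    proof (cases "?s = 0")
      case True
      then have "v i = 0" if "i \<in> {1..m}" for i using that by (simp add: sum_nonneg_eq_0_iff)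
      then show ?thesis by (simp add: D_def)
    next
      case False
      then have "0 < Q * ?s" using Q sum_nonneg[of "{1..m}" "\<lambda>i. \<bar>v i\<bar>"] by (simp add: order_less_le)
      from cube_int_imp_square[OF cD this] show ?thesis by simp
    qed
    then show "integrable P (\<lambda>z. (D z)\<^sup>2)" "(\<integral>z. (D z)\<^sup>2 \<partial>P) \<le> (Q * ?s)\<^sup>2" by auto
  qed
qed

text \<open>Integrating \<open>abs_add_cube_le\<close> removes its linear term. The nonnegative
  integral lets the estimate stand inside Tonelli's theorem before the polynomial is known to be
  integrable.\<close>

lemma moment_law_smoothness:
  fixes v :: "nat \<Rightarrow> real" and u :: real
  assumes P: "moment_law m Q P"
  defines "w \<equiv> Q * (\<Sum>i=1..m. \<bar>v i\<bar>)"
  shows "(\<integral>\<^sup>+z. ennreal (\<bar>u + (\<Sum>i=1..m. z i * v i)\<bar> ^ 3) \<partial>P) \<le> ennreal (\<bar>u\<bar> ^ 3 + 3 * \<bar>u\<bar> * w\<^sup>2 + w ^ 3)"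
proof -
  interpret prob_space P using P by (simp add: moment_law_def)
  define D where "D z = (\<Sum>i=1..m. z i * v i)" for z :: "nat \<Rightarrow> real"
  note lin = moment_law_linear[OF P, of v, folded D_def w_def, unfolded D_def[symmetric, abs_def]]
  have Dm[measurable]: "D \<in> borel_measurable P" using lin(2) by auto
  have i3: "integrable P (\<lambda>z. \<bar>D z\<bar> ^ 3)" and b3: "(\<integral>z. \<bar>D z\<bar> ^ 3 \<partial>P) \<le> w ^ 3"
    using lin(1) by (auto simp: cube_int_def)
  have int: "integrable P (\<lambda>z. \<bar>u\<bar> ^ 3 + 3 * u * \<bar>u\<bar> * D z + 3 * \<bar>u\<bar> * (D z)\<^sup>2 + \<bar>D z\<bar> ^ 3)"
    using lin(2,4) i3 by auto
  have nn: "0 \<le> \<bar>u\<bar> ^ 3 + 3 * u * \<bar>u\<bar> * D z + 3 * \<bar>u\<bar> * (D z)\<^sup>2 + \<bar>D z\<bar> ^ 3" for z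
    using abs_add_cube_le[of u "D z"] by (rule order_trans[rotated]) simp
  have "(\<integral>\<^sup>+z. ennreal (\<bar>u + D z\<bar> ^ 3) \<partial>P)
    \<le> (\<integral>\<^sup>+z. ennreal (\<bar>u\<bar> ^ 3 + 3 * u * \<bar>u\<bar> * D z + 3 * \<bar>u\<bar> * (D z)\<^sup>2 + \<bar>D z\<bar> ^ 3) \<partial>P)"
    by (intro nn_integral_mono ennreal_leI abs_add_cube_le)
  also have "\<dots> = ennreal (\<integral>z. \<bar>u\<bar> ^ 3 + 3 * u * \<bar>u\<bar> * D z + 3 * \<bar>u\<bar> * (D z)\<^sup>2 + \<bar>D z\<bar> ^ 3 \<partial>P)"
    using int nn by (intro nn_integral_eq_integral) auto
  also have "(\<integral>z. \<bar>u\<bar> ^ 3 + 3 * u * \<bar>u\<bar> * D z + 3 * \<bar>u\<bar> * (D z)\<^sup>2 + \<bar>D z\<bar> ^ 3 \<partial>P)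
    = \<bar>u\<bar> ^ 3 + 3 * \<bar>u\<bar> * (\<integral>z. (D z)\<^sup>2 \<partial>P) + (\<integral>z. \<bar>D z\<bar> ^ 3 \<partial>P)"
    using lin(2,3,4) i3 by (simp add: prob_space)
  also have "ennreal \<dots> \<le> ennreal (\<bar>u\<bar> ^ 3 + 3 * \<bar>u\<bar> * w\<^sup>2 + w ^ 3)"
    using lin(5) b3 by (intro ennreal_leI add_mono mult_left_mono) auto
  finally show ?thesis by (simp add: D_def)
qed

lemma mlpoly_measurable:
  assumes \<mu>: "\<And>n. moment_law m Q (\<mu> n)" and A: "admissible I m J A"
  shows "mlpoly J a A \<in> borel_measurable (PiM I \<mu>)"
  unfolding mlpoly_def[abs_def]
proof (intro borel_measurable_sum borel_measurable_times borel_measurable_prod borel_measurable_const)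
  fix j p assume j: "j \<in> J" "p \<in> A j"
  then have p: "fst p \<in> I" "snd p \<in> {1..m}" using A by (auto simp: admissible_def dest!: bspec subsetD)
  have "(\<lambda>z. z (snd p)) \<in> borel_measurable (\<mu> (fst p))"
    using \<mu>[of "fst p"] p by (auto simp: moment_law_def cube_int_def)
  from measurable_compose[OF measurable_component_singleton[OF p(1), of \<mu>] this]
  show "(\<lambda>x. x (fst p) (snd p)) \<in> borel_measurable (PiM I \<mu>)" .
qed

lemma sum_sqrt_square_le:
  fixes B :: "nat \<Rightarrow> real"
  assumes "\<And>i. i \<in> {1..m} \<Longrightarrow> 0 \<le> B i"
  shows "(\<Sum>i=1..m. sqrt (B i))\<^sup>2 \<le> m * (\<Sum>i=1..m. B i)"
  using Cauchy_Schwarz_ineq_sum[of "\<lambda>_. 1" "\<lambda>i. sqrt (B i)" "{1..m}"] assms by simp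

text \<open>Hypercontractivity. Given the earlier blocks, a new one adds a centred increment whose
  L3 norm is at most Q times the sum of the absolute partial derivatives; each addition is one use
  of \<open>cube_int_smoothness\<close>.\<close>

lemma mlpoly_cube_int:
  assumes \<mu>: "\<And>n. moment_law m Q (\<mu> n)" and I: "finite I" and A: "admissible I m J A"
  shows "cube_int (PiM I \<mu>) (mlpoly J a A) (sqrt (weight (9/4 * Q\<^sup>2 * m) J a A))"
  using I A
proof (induction I arbitrary: J A)
  case empty
  define L where "L = 9/4 * Q\<^sup>2 * m"
  have "A j = {}" if "j \<in> J" for j using empty that by (auto simp: admissible_def)
  \<comment> \<open>Without variables, injectivity of \<open>A\<close> leaves at most one monomial.
    Several constants could add up to a square larger than the sum of their squares.\<close>
  then have "j = k" if "j \<in> J" "k \<in> J" for j k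
    using empty that by (auto simp: admissible_def inj_on_def)
  then consider "J = {}" | j where "J = {j}" by blast
  then show ?case
  proof cases
    case 1
    then show ?thesis by (simp add: mlpoly_def weight_def cube_int_def)
  next
    case 2
    then have "A j = {}" using empty by (auto simp: admissible_def)
    interpret P: prob_space "PiM {} \<mu>" by (rule prob_space_PiM) simp
    from 2 \<open>A j = {}\<close> show ?thesis
      by (simp add: mlpoly_def[abs_def] weight_def cube_int_def P.prob_space)
  qed
next
  case (insert n I)
  interpret product_sigma_finite \<mu>
    using \<mu> by (auto simp: product_sigma_finite_def moment_law_def intro: prob_space_imp_sigma_finite)
  define L where "L = 9/4 * Q\<^sup>2 * m"
  have Q: "0 < Q" and L: "0 \<le> L" using \<mu>[of 0] by (auto simp: moment_law_def L_def)
  define U where "U = mlpoly {j\<in>J. n \<notin> fst ` A j} a A"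
  define V where "V i = mlpoly {j\<in>J. (n, i) \<in> A j} a (\<lambda>j. A j - {(n, i)})" for i
  define B where "B i = weight L {j\<in>J. (n, i) \<in> A j} a (\<lambda>j. A j - {(n, i)})" for i
  define A0 where "A0 = weight L {j\<in>J. n \<notin> fst ` A j} a A"
  have cU: "cube_int (PiM I \<mu>) U (sqrt A0)"
    unfolding U_def A0_def L_def by (rule insert.IH[OF admissible_rest[OF insert.prems]])
  have cV: "cube_int (PiM I \<mu>) (V i) (sqrt (B i))" for i
    unfolding V_def B_def L_def by (rule insert.IH[OF admissible_slice[OF insert.prems]])
  have B: "0 \<le> B i" "0 \<le> A0" for i unfolding B_def A0_def by (rule weight_nonneg[OF L])+
  define W where "W x = Q * (\<Sum>i=1..m. \<bar>V i x\<bar>)" for x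
  define e where "e = Q * (\<Sum>i=1..m. sqrt (B i))"
  have W0: "0 \<le> W x" for x unfolding W_def using Q by (intro mult_nonneg_nonneg sum_nonneg) auto
  have "cube_int (PiM I \<mu>) (\<lambda>x. \<Sum>i=1..m. \<bar>V i x\<bar>) (\<Sum>i=1..m. sqrt (B i))"
    by (rule cube_int_sum[OF _ cV]) simp
  then have cW: "cube_int (PiM I \<mu>) W e"
    using Q mult_left_mono[of _ _ "Q ^ 3"]
    by (auto simp: cube_int_def W_def[abs_def] e_def power_mult_distrib abs_mult)
  have split: "mlpoly J a A (x(n := z)) = U x + (\<Sum>i=1..m. z i * V i x)" for x z
    unfolding U_def V_def by (rule mlpoly_split[OF insert.prems])
  have w: "weight L J a A = A0 + L * (\<Sum>i=1..m. B i)"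
    unfolding A0_def B_def by (rule weight_split[OF insert.prems])
  have meas[measurable]: "mlpoly J a A \<in> borel_measurable (PiM (insert n I) \<mu>)"
    by (rule mlpoly_measurable[OF \<mu> insert.prems])
  have "(\<integral>\<^sup>+x. ennreal (\<bar>mlpoly J a A x\<bar> ^ 3) \<partial>PiM (insert n I) \<mu>)
    = (\<integral>\<^sup>+x. (\<integral>\<^sup>+z. ennreal (\<bar>mlpoly J a A (x(n := z))\<bar> ^ 3) \<partial>\<mu> n) \<partial>PiM I \<mu>)"
    by (rule product_nn_integral_insert[OF insert.hyps]) measurable
  also have "\<dots> \<le> (\<integral>\<^sup>+x. ennreal (\<bar>U x\<bar> ^ 3 + 3 * \<bar>U x\<bar> * (W x)\<^sup>2 + W x ^ 3) \<partial>PiM I \<mu>)"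
    unfolding split W_def by (intro nn_integral_mono moment_law_smoothness[OF \<mu>])
  also have "\<dots> = ennreal (\<integral>x. \<bar>U x\<bar> ^ 3 + 3 * \<bar>U x\<bar> * (W x)\<^sup>2 + W x ^ 3 \<partial>PiM I \<mu>)"
    using W0 by (intro nn_integral_eq_integral cube_int_smoothness(1)[OF cU cW W0]) auto
  also have "\<dots> \<le> ennreal (sqrt ((sqrt A0)\<^sup>2 + 9/4 * e\<^sup>2) ^ 3)"
    by (intro ennreal_leI cube_int_smoothness(2)[OF cU cW W0])
  also have "\<dots> \<le> ennreal (sqrt (weight L J a A) ^ 3)"
  proof (intro ennreal_leI power_mono real_sqrt_le_mono)
    \<comment> \<open>Cauchy-Schwarz over the partial derivatives of one block is the origin of the
      factor m in \<open>L\<close>.\<close>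
    have "9/4 * e\<^sup>2 = 9/4 * Q\<^sup>2 * (\<Sum>i=1..m. sqrt (B i))\<^sup>2" by (simp add: e_def power_mult_distrib)
    also have "\<dots> \<le> 9/4 * Q\<^sup>2 * (m * (\<Sum>i=1..m. B i))"
      using B by (intro mult_left_mono sum_sqrt_square_le) auto
    finally show "(sqrt A0)\<^sup>2 + 9/4 * e\<^sup>2 \<le> weight L J a A"
      unfolding w using B by (simp add: L_def mult_ac)
  qed simp
  finally have fin: "(\<integral>\<^sup>+x. ennreal (\<bar>mlpoly J a A x\<bar> ^ 3) \<partial>PiM (insert n I) \<mu>) \<le> ennreal (sqrt (weight L J a A) ^ 3)" .
  then have int: "integrable (PiM (insert n I) \<mu>) (\<lambda>x. \<bar>mlpoly J a A x\<bar> ^ 3)"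
    by (intro integrableI_nonneg) (auto simp: le_less_trans[OF _ ennreal_less_top])
  then have "(\<integral>x. \<bar>mlpoly J a A x\<bar> ^ 3 \<partial>PiM (insert n I) \<mu>) \<le> sqrt (weight L J a A) ^ 3"
    using fin nn_integral_eq_integral[OF int] weight_nonneg[OF L, of J a A] by simp
  then show ?case
    using int weight_nonneg[OF L, of J a A] by (simp add: cube_int_def L_def)
qed

section \<open>Lindeberg replacement\<close>

lemma moment_law_mono:
  assumes "moment_law m q P" "q \<le> Q"
  shows "moment_law m Q P"
proof -
  have q: "0 < q" using assms by (simp add: moment_law_def)
  then have "q ^ 3 \<le> Q ^ 3" using assms by (intro power_mono) auto
  then have "cube_int P g q \<Longrightarrow> cube_int P g Q" for g :: "(nat \<Rightarrow> real) \<Rightarrow> real"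
    using assms(2) unfolding cube_int_def by linarith
  then show ?thesis using assms q by (auto simp: moment_law_def)
qed

lemma taylor3:
  fixes fd :: "nat \<Rightarrow> real \<Rightarrow> real"
  assumes der: "\<And>k x. k < 3 \<Longrightarrow> (fd k has_real_derivative fd (Suc k) x) (at x)"
    and F: "\<And>x. \<bar>fd 3 x\<bar> \<le> F"
  shows "\<bar>fd 0 (u + d) - (fd 0 u + fd 1 u * d + fd 2 u / 2 * d\<^sup>2)\<bar> \<le> F / 6 * \<bar>d\<bar> ^ 3"
proof -
  have sum3: "(\<Sum>k<3. h k) = h 0 + h 1 + h 2" for h :: "nat \<Rightarrow> real" by (simp add: numeral_eq_Suc)
  have f3: "fact 3 = (6::real)" by (simp add: numeral_eq_Suc)
  have "\<exists>t. fd 0 (u + d) = (\<Sum>k<3. (fd k u / fact k) * d ^ k) + (fd 3 t / fact 3) * d ^ 3"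
  proof (cases d "0::real" rule: linorder_cases)
    case less
    have "\<exists>t. u + d < t \<and> t < u \<and> fd 0 (u + d) = (\<Sum>k<3. (fd k u / fact k) * (u + d - u) ^ k) + (fd 3 t / fact 3) * (u + d - u) ^ 3"
      by (rule Taylor_down[where b=u]) (use der less in \<open>simp_all\<close>)
    then show ?thesis by (simp only: add_diff_cancel_left') blast
  next
    case equal
    then show ?thesis by (simp add: sum3)
  next
    case greater
    have "\<exists>t. u < t \<and> t < u + d \<and> fd 0 (u + d) = (\<Sum>k<3. (fd k u / fact k) * (u + d - u) ^ k) + (fd 3 t / fact 3) * (u + d - u) ^ 3"
      by (rule Taylor_up[where a=u]) (use der greater in \<open>simp_all\<close>)
    then show ?thesis by (simp only: add_diff_cancel_left') blast
  qed
  then obtain t where t: "fd 0 (u + d) = (\<Sum>k<3. (fd k u / fact k) * d ^ k) + (fd 3 t / fact 3) * d ^ 3"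
    by auto
  have "fd 0 (u + d) - (fd 0 u + fd 1 u * d + fd 2 u / 2 * d\<^sup>2) = fd 3 t / 6 * d ^ 3"
    unfolding t sum3 f3 by simp
  also have "\<bar>\<dots>\<bar> = \<bar>fd 3 t\<bar> / 6 * \<bar>d\<bar> ^ 3" by (simp add: abs_mult power_abs)
  also have "\<dots> \<le> F / 6 * \<bar>d\<bar> ^ 3" using F[of t] by (intro mult_right_mono divide_right_mono) auto
  finally show ?thesis .
qed

text \<open>\<open>fd k\<close> stands for the k-th derivative. \<open>C\<close> secures the
  integrability of \<open>fd 0\<close> along the polynomials, \<open>F\<close> measures the Taylor
  remainder.\<close>

locale bounded_smooth3 =
  fixes fd :: "nat \<Rightarrow> real \<Rightarrow> real" and F C :: real
  assumes der: "\<And>k x. k < 3 \<Longrightarrow> (fd k has_real_derivative fd (Suc k) x) (at x)"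
    and F: "\<And>x. \<bar>fd 3 x\<bar> \<le> F"
    and C: "\<And>x. \<bar>fd 0 x\<bar> \<le> C"
begin

lemma F_nonneg: "0 \<le> F" using F[of 0] by linarith

lemma measurable_fd0[measurable]: "fd 0 \<in> borel_measurable borel"
  by (intro borel_measurable_continuous_onI continuous_at_imp_continuous_on ballI DERIV_isCont[OF der]) simp

text \<open>Since the block is centred, the expected second-order Taylor polynomial depends on its
  law only through the second moment of the linear form.\<close>

lemma moment_law_taylor:
  fixes v :: "nat \<Rightarrow> real"
  assumes P: "moment_law m Q P"
  shows "\<bar>(\<integral>z. fd 0 (u + (\<Sum>i=1..m. z i * v i)) \<partial>P) - (fd 0 u + fd 2 u / 2 * (\<integral>z. (\<Sum>i=1..m. z i * v i)\<^sup>2 \<partial>P))\<bar>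
    \<le> F / 6 * (Q ^ 3 * (\<Sum>i=1..m. \<bar>v i\<bar>) ^ 3)"
proof -
  interpret prob_space P using P by (simp add: moment_law_def)
  define D where "D z = (\<Sum>i=1..m. z i * v i)" for z :: "nat \<Rightarrow> real"
  note lin = moment_law_linear[OF P, of v, folded D_def, unfolded D_def[symmetric, abs_def]]
  have Dm[measurable]: "D \<in> borel_measurable P" using lin(2) by auto
  have i3: "integrable P (\<lambda>z. \<bar>D z\<bar> ^ 3)" and b3: "(\<integral>z. \<bar>D z\<bar> ^ 3 \<partial>P) \<le> (Q * (\<Sum>i=1..m. \<bar>v i\<bar>)) ^ 3"
    using lin(1) by (auto simp: cube_int_def)
  have if0: "integrable P (\<lambda>z. fd 0 (u + D z))"
    by (rule integrable_const_bound[where B=C]) (use C in auto)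
  have iT: "integrable P (\<lambda>z. fd 0 u + fd 1 u * D z + fd 2 u / 2 * (D z)\<^sup>2)"
    using lin(2,4) by auto
  have "(\<integral>z. fd 0 u + fd 1 u * D z + fd 2 u / 2 * (D z)\<^sup>2 \<partial>P) = fd 0 u + fd 2 u / 2 * (\<integral>z. (D z)\<^sup>2 \<partial>P)"
    using lin(2,3,4) by (simp add: prob_space)
  then have diff: "(\<integral>z. fd 0 (u + D z) \<partial>P) - (fd 0 u + fd 2 u / 2 * (\<integral>z. (D z)\<^sup>2 \<partial>P))
    = (\<integral>z. fd 0 (u + D z) - (fd 0 u + fd 1 u * D z + fd 2 u / 2 * (D z)\<^sup>2) \<partial>P)"
    by (subst Bochner_Integration.integral_diff[OF if0 iT]) simp
  have "\<bar>(\<integral>z. fd 0 (u + D z) \<partial>P) - (fd 0 u + fd 2 u / 2 * (\<integral>z. (D z)\<^sup>2 \<partial>P))\<bar>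
    \<le> (\<integral>z. \<bar>fd 0 (u + D z) - (fd 0 u + fd 1 u * D z + fd 2 u / 2 * (D z)\<^sup>2)\<bar> \<partial>P)"
    unfolding diff by (rule integral_abs_bound)
  also have "\<dots> \<le> (\<integral>z. F / 6 * \<bar>D z\<bar> ^ 3 \<partial>P)"
  proof (rule integral_mono)
    show "integrable P (\<lambda>z. \<bar>fd 0 (u + D z) - (fd 0 u + fd 1 u * D z + fd 2 u / 2 * (D z)\<^sup>2)\<bar>)"
      by (rule integrable_abs[OF Bochner_Integration.integrable_diff[OF if0 iT]])
    show "integrable P (\<lambda>z. F / 6 * \<bar>D z\<bar> ^ 3)"
      by (rule integrable_mult_right[OF i3])
    show "\<bar>fd 0 (u + D z) - (fd 0 u + fd 1 u * D z + fd 2 u / 2 * (D z)\<^sup>2)\<bar> \<le> F / 6 * \<bar>D z\<bar> ^ 3" for z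
      by (rule taylor3) (rule der F, assumption?)+
  qed
  also have "\<dots> = F / 6 * (\<integral>z. \<bar>D z\<bar> ^ 3 \<partial>P)" by simp
  also have "\<dots> \<le> F / 6 * (Q * (\<Sum>i=1..m. \<bar>v i\<bar>)) ^ 3"
    using b3 F_nonneg by (intro mult_left_mono) auto
  finally show ?thesis by (simp add: power_mult_distrib D_def)
qed

text \<open>Equal covariances give both laws the same expected Taylor polynomial; both integrals are
  compared with it, and the two remainders add up.\<close>

lemma moment_law_exchange:
  fixes v :: "nat \<Rightarrow> real"
  assumes P: "moment_law m Q P" and P': "moment_law m Q' P'"
    and cov: "\<And>i j. i \<in> {1..m} \<Longrightarrow> j \<in> {1..m} \<Longrightarrow> (\<integral>z. z i * z j \<partial>P) = (\<integral>z. z i * z j \<partial>P')"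
  shows "\<bar>(\<integral>z. fd 0 (u + (\<Sum>i=1..m. z i * v i)) \<partial>P) - (\<integral>z. fd 0 (u + (\<Sum>i=1..m. z i * v i)) \<partial>P')\<bar>
    \<le> F / 6 * (Q ^ 3 + Q' ^ 3) * (\<Sum>i=1..m. \<bar>v i\<bar>) ^ 3"
proof -
  have second: "(\<integral>z. (\<Sum>i=1..m. z i * v i)\<^sup>2 \<partial>R) = (\<Sum>i=1..m. \<Sum>j=1..m. v i * v j * (\<integral>z. z i * z j \<partial>R))"
    if R: "moment_law m q R" for R q
  proof -
    interpret prob_space R using R by (simp add: moment_law_def)
    have q: "0 < q" using R by (simp add: moment_law_def)
    have c: "cube_int R (\<lambda>z. z i) q" if "i \<in> {1..m}" for i using R that by (simp add: moment_law_def)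
    have [measurable]: "(\<lambda>z. z i) \<in> borel_measurable R" if "i \<in> {1..m}" for i
      using c[OF that] by (simp add: cube_int_def)
    have "integrable R (\<lambda>z. z i * z j)" if ij: "i \<in> {1..m}" "j \<in> {1..m}" for i j
    proof (rule Bochner_Integration.integrable_bound)
      show "integrable R (\<lambda>z. (z i)\<^sup>2 + (z j)\<^sup>2)"
        using cube_int_imp_square(1)[OF c q] ij by auto
      have "\<bar>x * y\<bar> \<le> x\<^sup>2 + y\<^sup>2" for x y :: real
      proof -
        have "0 \<le> (\<bar>x\<bar> - \<bar>y\<bar>)\<^sup>2 + \<bar>x * y\<bar>" by simp
        also have "\<dots> = x\<^sup>2 + y\<^sup>2 - \<bar>x * y\<bar>" by (simp add: power2_diff abs_mult)
        finally show ?thesis by simp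
      qed
      then show "AE z in R. norm (z i * z j) \<le> norm ((z i)\<^sup>2 + (z j)\<^sup>2)" by simp
      show "(\<lambda>z. z i * z j) \<in> borel_measurable R" using ij by measurable
    qed
    then have int: "integrable R (\<lambda>z. v i * v j * (z i * z j))" if "i \<in> {1..m}" "j \<in> {1..m}" for i j
      using that by simp
    have "(\<integral>z. (\<Sum>i=1..m. z i * v i)\<^sup>2 \<partial>R) = (\<integral>z. (\<Sum>i=1..m. \<Sum>j=1..m. v i * v j * (z i * z j)) \<partial>R)"
      by (simp add: power2_eq_square sum_product mult_ac)
    also have "\<dots> = (\<Sum>i=1..m. \<integral>z. (\<Sum>j=1..m. v i * v j * (z i * z j)) \<partial>R)"
      by (intro Bochner_Integration.integral_sum Bochner_Integration.integrable_sum int)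
    also have "\<dots> = (\<Sum>i=1..m. \<Sum>j=1..m. \<integral>z. v i * v j * (z i * z j) \<partial>R)"
      by (intro sum.cong refl Bochner_Integration.integral_sum int)
    finally show ?thesis by simp
  qed
  have eq: "(\<integral>z. (\<Sum>i=1..m. z i * v i)\<^sup>2 \<partial>P) = (\<integral>z. (\<Sum>i=1..m. z i * v i)\<^sup>2 \<partial>P')"
    unfolding second[OF P] second[OF P'] using cov by (intro sum.cong) auto
  have tri: "\<bar>x - t\<bar> \<le> a \<Longrightarrow> \<bar>y - t\<bar> \<le> b \<Longrightarrow> \<bar>x - y\<bar> \<le> a + b" for x y t a b :: real by linarith
  have "\<bar>(\<integral>z. fd 0 (u + (\<Sum>i=1..m. z i * v i)) \<partial>P) - (\<integral>z. fd 0 (u + (\<Sum>i=1..m. z i * v i)) \<partial>P')\<bar>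
    \<le> F / 6 * (Q ^ 3 * (\<Sum>i=1..m. \<bar>v i\<bar>) ^ 3) + F / 6 * (Q' ^ 3 * (\<Sum>i=1..m. \<bar>v i\<bar>) ^ 3)"
    by (rule tri[OF moment_law_taylor[OF P, of u v, unfolded eq] moment_law_taylor[OF P', of u v]])
  also have "\<dots> = F / 6 * (Q ^ 3 + Q' ^ 3) * (\<Sum>i=1..m. \<bar>v i\<bar>) ^ 3"
    by (simp only: distrib_left distrib_right mult.assoc)
  finally show ?thesis .
qed

text \<open>By Fubini the other blocks, with the same joint law \<open>R\<close> on both sides, are
  frozen while block k is exchanged. \<open>Q\<close> enters through the partial derivatives,
  \<open>Q1\<close> and \<open>Q2\<close> through the exchanged block alone: this separates the
  maximum from the sum of cubes in the final constant.\<close>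

lemma exchange_one:
  assumes \<mu>: "\<And>n. moment_law m Q (\<mu> n)" and \<nu>: "\<And>n. moment_law m Q (\<nu> n)"
    and same: "\<And>n. n \<in> I \<Longrightarrow> \<mu> n = \<nu> n"
    and P: "moment_law m Q1 (\<mu> k)" and P': "moment_law m Q2 (\<nu> k)"
    and cov: "\<And>i j. i \<in> {1..m} \<Longrightarrow> j \<in> {1..m} \<Longrightarrow> (\<integral>z. z i * z j \<partial>\<mu> k) = (\<integral>z. z i * z j \<partial>\<nu> k)"
    and I: "finite I" "k \<notin> I" and A: "admissible (insert k I) m J A"
  shows "\<bar>(\<integral>x. fd 0 (mlpoly J a A x) \<partial>PiM (insert k I) \<mu>) - (\<integral>x. fd 0 (mlpoly J a A x) \<partial>PiM (insert k I) \<nu>)\<bar>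
    \<le> F / 6 * (Q1 ^ 3 + Q2 ^ 3) *
        sqrt (m * (\<Sum>i=1..m. weight (9/4 * Q\<^sup>2 * m) {j\<in>J. (k, i) \<in> A j} a (\<lambda>j. A j - {(k, i)}))) ^ 3"
proof -
  define h where "h x = fd 0 (mlpoly J a A x)" for x
  define L where "L = 9/4 * Q\<^sup>2 * m"
  have L: "0 \<le> L" by (simp add: L_def)
  have Q12: "0 < Q1" "0 < Q2" using P P' by (auto simp: moment_law_def)
  define U where "U = mlpoly {j\<in>J. k \<notin> fst ` A j} a A"
  define V where "V i = mlpoly {j\<in>J. (k, i) \<in> A j} a (\<lambda>j. A j - {(k, i)})" for i
  define B where "B i = weight L {j\<in>J. (k, i) \<in> A j} a (\<lambda>j. A j - {(k, i)})" for i
  define R where "R = PiM I \<mu>"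
  have R': "PiM I \<nu> = R" unfolding R_def using same by (intro PiM_cong) auto
  interpret R: prob_space R unfolding R_def
    using \<mu> by (intro prob_space_PiM) (auto simp: moment_law_def)
  have inner: "integrable R (\<lambda>x. \<integral>z. h (x(k := z)) \<partial>\<kappa> k)"
      "(\<integral>x. h x \<partial>PiM (insert k I) \<kappa>) = (\<integral>x. (\<integral>z. h (x(k := z)) \<partial>\<kappa> k) \<partial>R)"
    if law: "\<And>n. moment_law m Q (\<kappa> n)" and RL: "PiM I \<kappa> = R" for \<kappa>
  proof -
    interpret K: prob_space "\<kappa> k" using law by (simp add: moment_law_def)
    interpret product_sigma_finite \<kappa>
      using law by (auto simp: product_sigma_finite_def moment_law_def intro: prob_space_imp_sigma_finite)
    interpret T: prob_space "PiM (insert k I) \<kappa>"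
      using law by (intro prob_space_PiM) (auto simp: moment_law_def)
    have mS[measurable]: "mlpoly J a A \<in> borel_measurable (PiM (insert k I) \<kappa>)"
      by (rule mlpoly_measurable[OF law A])
    have mh[measurable]: "h \<in> borel_measurable (PiM (insert k I) \<kappa>)" unfolding h_def[abs_def] by measurable
    have ih: "integrable (PiM (insert k I) \<kappa>) h"
      by (rule T.integrable_const_bound[where B=C]) (use C in \<open>auto simp: h_def\<close>)
    show "(\<integral>x. h x \<partial>PiM (insert k I) \<kappa>) = (\<integral>x. (\<integral>z. h (x(k := z)) \<partial>\<kappa> k) \<partial>R)"
      using product_integral_insert[OF I ih] by (simp add: RL)
    have "(\<lambda>(x, z). x(k := z)) \<in> measurable (R \<Otimes>\<^sub>M \<kappa> k) (PiM (insert k I) \<kappa>)"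
      unfolding RL[symmetric] by (rule measurable_add_dim)
    from measurable_compose[OF this mh]
    have mpair: "(\<lambda>(x, z). h (x(k := z))) \<in> borel_measurable (R \<Otimes>\<^sub>M \<kappa> k)"
      by (simp add: case_prod_beta')
    show "integrable R (\<lambda>x. \<integral>z. h (x(k := z)) \<partial>\<kappa> k)"
    proof (rule R.integrable_const_bound[where B=C])
      show "(\<lambda>x. \<integral>z. h (x(k := z)) \<partial>\<kappa> k) \<in> borel_measurable R"
        by (rule K.borel_measurable_lebesgue_integral[OF mpair])
      have "\<bar>\<integral>z. h (x(k := z)) \<partial>\<kappa> k\<bar> \<le> C" if "x \<in> space R" for x
      proof -
        have "(\<lambda>z. h (x(k := z))) \<in> borel_measurable (\<kappa> k)"
          using measurable_compose[OF measurable_Pair1'[OF that] mpair] by simp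
        then have "integrable (\<kappa> k) (\<lambda>z. h (x(k := z)))"
          by (intro K.integrable_const_bound[where B=C]) (use C in \<open>auto simp: h_def\<close>)
        then have "(\<integral>z. \<bar>h (x(k := z))\<bar> \<partial>\<kappa> k) \<le> C"
          using C by (intro K.integral_le_const integrable_abs) (auto simp: h_def)
        then show ?thesis using integral_abs_bound[of "\<kappa> k" "\<lambda>z. h (x(k := z))"] by linarith
      qed
      then show "AE x in R. norm (\<integral>z. h (x(k := z)) \<partial>\<kappa> k) \<le> C" by simp
    qed
  qed
  have cV: "cube_int R (V i) (sqrt (B i))" for i
    unfolding R_def V_def B_def L_def by (rule mlpoly_cube_int[OF \<mu> I(1) admissible_slice[OF A]])
  have "cube_int R (\<lambda>x. \<Sum>i=1..m. \<bar>V i x\<bar>) (\<Sum>i=1..m. sqrt (B i))"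
    by (rule cube_int_sum[OF _ cV]) simp
  then have iV: "integrable R (\<lambda>x. (\<Sum>i=1..m. \<bar>V i x\<bar>) ^ 3)"
    and bV: "(\<integral>x. (\<Sum>i=1..m. \<bar>V i x\<bar>) ^ 3 \<partial>R) \<le> (\<Sum>i=1..m. sqrt (B i)) ^ 3"
    by (simp_all add: cube_int_def abs_of_nonneg sum_nonneg)
  have split: "h (x(k := z)) = fd 0 (U x + (\<Sum>i=1..m. z i * V i x))" for x z
    unfolding U_def V_def h_def by (subst mlpoly_split[OF A]) simp
  have "(\<integral>x. h x \<partial>PiM (insert k I) \<mu>) - (\<integral>x. h x \<partial>PiM (insert k I) \<nu>)
    = (\<integral>x. (\<integral>z. h (x(k := z)) \<partial>\<mu> k) - (\<integral>z. h (x(k := z)) \<partial>\<nu> k) \<partial>R)"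
    using inner[OF \<mu> R_def[symmetric]] inner[OF \<nu> R'] by simp
  also have "\<bar>\<dots>\<bar> \<le> (\<integral>x. \<bar>(\<integral>z. h (x(k := z)) \<partial>\<mu> k) - (\<integral>z. h (x(k := z)) \<partial>\<nu> k)\<bar> \<partial>R)"
    by (rule integral_abs_bound)
  also have "\<dots> \<le> (\<integral>x. F / 6 * (Q1 ^ 3 + Q2 ^ 3) * (\<Sum>i=1..m. \<bar>V i x\<bar>) ^ 3 \<partial>R)"
  proof (rule integral_mono)
    show "integrable R (\<lambda>x. \<bar>(\<integral>z. h (x(k := z)) \<partial>\<mu> k) - (\<integral>z. h (x(k := z)) \<partial>\<nu> k)\<bar>)"
      using inner[OF \<mu> R_def[symmetric]] inner[OF \<nu> R'] by auto
    show "integrable R (\<lambda>x. F / 6 * (Q1 ^ 3 + Q2 ^ 3) * (\<Sum>i=1..m. \<bar>V i x\<bar>) ^ 3)"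
      using iV by simp
    show "\<bar>(\<integral>z. h (x(k := z)) \<partial>\<mu> k) - (\<integral>z. h (x(k := z)) \<partial>\<nu> k)\<bar> \<le> F / 6 * (Q1 ^ 3 + Q2 ^ 3) * (\<Sum>i=1..m. \<bar>V i x\<bar>) ^ 3" for x
      unfolding split by (rule moment_law_exchange[OF P P' cov])
  qed
  also have "\<dots> = F / 6 * (Q1 ^ 3 + Q2 ^ 3) * (\<integral>x. (\<Sum>i=1..m. \<bar>V i x\<bar>) ^ 3 \<partial>R)" by simp
  also have "\<dots> \<le> F / 6 * (Q1 ^ 3 + Q2 ^ 3) * sqrt (m * (\<Sum>i=1..m. B i)) ^ 3"
  proof (rule mult_left_mono)
    have B: "0 \<le> B i" for i unfolding B_def by (rule weight_nonneg[OF L])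
    have "(\<Sum>i=1..m. sqrt (B i)) \<le> sqrt (m * (\<Sum>i=1..m. B i))"
      using sum_sqrt_square_le[of m B] B by (intro real_le_rsqrt) auto
    then have "(\<Sum>i=1..m. sqrt (B i)) ^ 3 \<le> sqrt (m * (\<Sum>i=1..m. B i)) ^ 3"
      using B by (intro power_mono sum_nonneg) auto
    with bV show "(\<integral>x. (\<Sum>i=1..m. \<bar>V i x\<bar>) ^ 3 \<partial>R) \<le> sqrt (m * (\<Sum>i=1..m. B i)) ^ 3" by linarith
    show "0 \<le> F / 6 * (Q1 ^ 3 + Q2 ^ 3)" using F_nonneg Q12 by simp
  qed
  finally show ?thesis by (simp add: h_def B_def L_def)
qed

text \<open>After removal of a variable the degree is at most N, whence \<open>L ^ N\<close>. At L =
  1, \<open>weight_split\<close> expresses that the slices over i partition the monomials involving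
  block k.\<close>

lemma slice_weight_le:
  assumes A: "admissible (insert k I) m J A" and N: "\<And>j. j \<in> J \<Longrightarrow> card (A j) \<le> Suc N"
    and L: "1 \<le> L"
  shows "(\<Sum>i=1..m. weight L {j\<in>J. (k, i) \<in> A j} a (\<lambda>j. A j - {(k, i)})) \<le> L ^ N * (\<Sum>j | j \<in> J \<and> k \<in> fst ` A j. (a j)\<^sup>2)"
proof -
  have J: "finite J" using A by (simp add: admissible_def)
  have "weight L {j\<in>J. (k, i) \<in> A j} a (\<lambda>j. A j - {(k, i)}) \<le> L ^ N * weight 1 {j\<in>J. (k, i) \<in> A j} a (\<lambda>j. A j - {(k, i)})" for i
    unfolding weight_def sum_distrib_left
  proof (intro sum_mono)
    fix j assume j: "j \<in> {j \<in> J. (k, i) \<in> A j}"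
    then have "finite (A j)" using A by (simp add: admissible_def)
    then have "card (A j - {(k, i)}) \<le> N" using N[of j] j by (simp add: card_Diff_singleton)
    then have "L ^ card (A j - {(k, i)}) \<le> L ^ N" using L by (intro power_increasing) auto
    then show "(a j)\<^sup>2 * L ^ card (A j - {(k, i)}) \<le> L ^ N * ((a j)\<^sup>2 * 1 ^ card (A j - {(k, i)}))"
      using mult_left_mono[of "L ^ card (A j - {(k, i)})" "L ^ N" "(a j)\<^sup>2"] by (simp add: mult.commute)
  qed
  then have "(\<Sum>i=1..m. weight L {j\<in>J. (k, i) \<in> A j} a (\<lambda>j. A j - {(k, i)}))
    \<le> L ^ N * (\<Sum>i=1..m. weight 1 {j\<in>J. (k, i) \<in> A j} a (\<lambda>j. A j - {(k, i)}))"
    unfolding sum_distrib_left by (intro sum_mono)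
  also have "(\<Sum>i=1..m. weight 1 {j\<in>J. (k, i) \<in> A j} a (\<lambda>j. A j - {(k, i)}))
    = weight 1 J a A - weight 1 {j\<in>J. k \<notin> fst ` A j} a A"
    using weight_split[OF A, of 1 a] by simp
  also have "\<dots> = (\<Sum>j\<in>J - {j\<in>J. k \<notin> fst ` A j}. (a j)\<^sup>2)"
    using J by (simp add: weight_def sum_diff)
  also have "J - {j\<in>J. k \<notin> fst ` A j} = {j. j \<in> J \<and> k \<in> fst ` A j}" by auto
  finally show ?thesis .
qed

text \<open>With q k the influence of block k, one replacement costs a multiple of (q k)^(3/2) <= q
  k * \<delta>. Summation over k counts each monomial once for every block in it, at most
  \<open>Suc N\<close> times.\<close>

lemma lindeberg_product:
  fixes a :: "'j \<Rightarrow> real" and \<delta> :: real and m N :: nat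
  assumes \<mu>: "\<And>n. moment_law m Q1 (\<mu> n)" and \<nu>: "\<And>n. moment_law m Q2 (\<nu> n)"
    and cov: "\<And>n i j. i \<in> {1..m} \<Longrightarrow> j \<in> {1..m} \<Longrightarrow> (\<integral>z. z i * z j \<partial>\<mu> n) = (\<integral>z. z i * z j \<partial>\<nu> n)"
    and A: "admissible {..<K} m J A" and N: "\<And>j. j \<in> J \<Longrightarrow> card (A j) \<le> Suc N"
    and Q: "1 \<le> Q1" "1 \<le> Q2" and m: "1 \<le> m"
    and \<delta>: "0 \<le> \<delta>" "\<And>k. (\<Sum>j | j \<in> J \<and> k \<in> fst ` A j. (a j)\<^sup>2) \<le> \<delta>\<^sup>2"
  shows "\<bar>(\<integral>x. fd 0 (mlpoly J a A x) \<partial>PiM {..<K} \<mu>) - (\<integral>x. fd 0 (mlpoly J a A x) \<partial>PiM {..<K} \<nu>)\<bar>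
    \<le> F / 6 * (Q1 ^ 3 + Q2 ^ 3) * (sqrt m ^ 3 * (3/2 * max Q1 Q2 * sqrt m) ^ (3 * N)) * (Suc N * (\<Sum>j\<in>J. (a j)\<^sup>2) * \<delta>)"
proof -
  have J: "finite J" using A by (simp add: admissible_def)
  define Q where "Q = max Q1 Q2"
  define L where "L = 9/4 * Q\<^sup>2 * m"
  have "1 \<le> Q" using Q by (simp add: Q_def)
  then have "1 * 1 * 1 \<le> L" unfolding L_def using m one_le_power[of Q 2] by (intro mult_mono) auto
  then have L: "1 \<le> L" by simp
  have sqrtL: "sqrt (L ^ N) = (3/2 * Q * sqrt m) ^ N"
  proof -
    have "sqrt L = 3/2 * Q * sqrt m" using \<open>1 \<le> Q\<close> unfolding L_def
      by (simp add: real_sqrt_mult real_sqrt_divide)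
    then show ?thesis by (simp only: real_sqrt_power)
  qed
  have lawQ: "moment_law m Q P" if "moment_law m q P" "q \<le> Q" for P q
    using that by (rule moment_law_mono)
  define q where "q k = (\<Sum>j | j \<in> J \<and> k \<in> fst ` A j. (a j)\<^sup>2)" for k
  have q0: "0 \<le> q k" for k unfolding q_def by (intro sum_nonneg) auto
  define E where "E = F / 6 * (Q1 ^ 3 + Q2 ^ 3)"
  have E: "0 \<le> E" using F_nonneg Q by (simp add: E_def)
  \<comment> \<open>The blocks before k are already replaced, so consecutive hybrids differ in block
    k alone.\<close>
  define \<Lambda> where "\<Lambda> k n = (if n < k then \<nu> n else \<mu> n)" for k n
  have law: "moment_law m Q (\<Lambda> k n)" for k n
    using lawQ[OF \<mu>] lawQ[OF \<nu>] by (simp add: \<Lambda>_def Q_def)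
  define H where "H k = (\<integral>x. fd 0 (mlpoly J a A x) \<partial>PiM {..<K} (\<Lambda> k))" for k
  have step: "\<bar>H k - H (Suc k)\<bar> \<le> E * (sqrt m ^ 3 * (3/2 * Q * sqrt m) ^ (3 * N)) * (q k * \<delta>)" if k: "k < K" for k
  proof -
    have ins: "{..<K} = insert k ({..<K} - {k})" using k by auto
    have A': "admissible (insert k ({..<K} - {k})) m J A" using A ins by simp
    define T where "T = (\<Sum>i=1..m. weight (9/4 * Q\<^sup>2 * m) {j\<in>J. (k, i) \<in> A j} a (\<lambda>j. A j - {(k, i)}))"
    have "\<bar>H k - H (Suc k)\<bar> \<le> E * sqrt (m * T) ^ 3"
      unfolding H_def E_def T_def
      by (subst (1 2) ins, rule exchange_one[OF law law _ _ _ _ _ _ A'])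
         (use \<mu> \<nu> cov in \<open>auto simp: \<Lambda>_def\<close>)
    also have "\<dots> \<le> E * sqrt (m * (L ^ N * q k)) ^ 3"
    proof (intro mult_left_mono power_mono real_sqrt_le_mono E)
      show "T \<le> L ^ N * q k"
        using slice_weight_le[OF A' N L] by (simp add: T_def L_def q_def)
      show "0 \<le> sqrt (m * T)"
        unfolding T_def by (intro real_sqrt_ge_zero mult_nonneg_nonneg sum_nonneg weight_nonneg) auto
    qed simp
    also have "sqrt (m * (L ^ N * q k)) ^ 3 = (sqrt m ^ 3 * (3/2 * Q * sqrt m) ^ (3 * N)) * sqrt (q k) ^ 3"
      by (simp only: real_sqrt_mult sqrtL power_mult_distrib[of "sqrt m"] power_mult_distrib[of "_ ^ N"]
          power_mult[symmetric] mult.commute[of N 3] mult.assoc)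
    also have "E * \<dots> \<le> E * ((sqrt m ^ 3 * (3/2 * Q * sqrt m) ^ (3 * N)) * (q k * \<delta>))"
    proof (intro mult_left_mono E)
      have "sqrt (q k) \<le> \<delta>" using \<delta> by (intro real_le_lsqrt) (auto simp: q_def)
      then have "q k * sqrt (q k) \<le> q k * \<delta>" using q0 by (intro mult_left_mono)
      then show "sqrt (q k) ^ 3 \<le> q k * \<delta>" using q0[of k] by (simp add: power3_eq_cube)
      show "0 \<le> sqrt m ^ 3 * (3/2 * Q * sqrt m) ^ (3 * N)" using \<open>1 \<le> Q\<close> by simp
    qed
    finally show ?thesis by (simp add: mult.assoc)
  qed
  have HK: "H 0 = (\<integral>x. fd 0 (mlpoly J a A x) \<partial>PiM {..<K} \<mu>)" "H K = (\<integral>x. fd 0 (mlpoly J a A x) \<partial>PiM {..<K} \<nu>)"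
  proof -
    have "PiM {..<K} (\<Lambda> 0) = PiM {..<K} \<mu>" "PiM {..<K} (\<Lambda> K) = PiM {..<K} \<nu>"
      by (auto intro!: PiM_cong simp: \<Lambda>_def)
    then show "H 0 = (\<integral>x. fd 0 (mlpoly J a A x) \<partial>PiM {..<K} \<mu>)" "H K = (\<integral>x. fd 0 (mlpoly J a A x) \<partial>PiM {..<K} \<nu>)"
      by (simp_all add: H_def)
  qed
  have "H 0 - H K = (\<Sum>k<K. H k - H (Suc k))" by (rule sum_lessThan_telescope'[symmetric])
  also have "\<bar>\<dots>\<bar> \<le> (\<Sum>k<K. \<bar>H k - H (Suc k)\<bar>)" by (rule sum_abs)
  also have "\<dots> \<le> (\<Sum>k<K. E * (sqrt m ^ 3 * (3/2 * Q * sqrt m) ^ (3 * N)) * (q k * \<delta>))"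
    by (intro sum_mono step) simp
  also have "\<dots> = E * (sqrt m ^ 3 * (3/2 * Q * sqrt m) ^ (3 * N)) * ((\<Sum>k<K. q k) * \<delta>)"
    by (simp add: sum_distrib_left sum_distrib_right)
  also have "\<dots> \<le> E * (sqrt m ^ 3 * (3/2 * Q * sqrt m) ^ (3 * N)) * ((Suc N * (\<Sum>j\<in>J. (a j)\<^sup>2)) * \<delta>)"
  proof (intro mult_left_mono mult_right_mono \<delta>(1))
    have "(\<Sum>k<K. q k) = (\<Sum>k<K. \<Sum>j\<in>J. if k \<in> fst ` A j then (a j)\<^sup>2 else 0)"
      unfolding q_def by (intro sum.cong refl sum.inter_filter J)
    also have "\<dots> = (\<Sum>j\<in>J. \<Sum>k<K. if k \<in> fst ` A j then (a j)\<^sup>2 else 0)" by (rule sum.swap)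
    also have "\<dots> \<le> (\<Sum>j\<in>J. Suc N * (a j)\<^sup>2)"
    proof (rule sum_mono)
      fix j assume j: "j \<in> J"
      have fin: "finite (A j)" using j A by (simp add: admissible_def)
      have "(\<Sum>k<K. if k \<in> fst ` A j then (a j)\<^sup>2 else 0) = card ({..<K} \<inter> fst ` A j) * (a j)\<^sup>2"
        by (simp add: sum.If_cases)
      also have "\<dots> \<le> Suc N * (a j)\<^sup>2"
      proof (intro mult_right_mono)
        have "card ({..<K} \<inter> fst ` A j) \<le> card (fst ` A j)" using fin by (intro card_mono) auto
        also have "\<dots> \<le> card (A j)" using fin by (rule card_image_le)
        finally show "real (card ({..<K} \<inter> fst ` A j)) \<le> real (Suc N)" using N[OF j] by linarith
      qed simp
      finally show "(\<Sum>k<K. if k \<in> fst ` A j then (a j)\<^sup>2 else 0) \<le> Suc N * (a j)\<^sup>2" .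
    qed
    finally show "(\<Sum>k<K. q k) \<le> Suc N * (\<Sum>j\<in>J. (a j)\<^sup>2)" by (simp add: sum_distrib_left)
    show "0 \<le> E * (sqrt m ^ 3 * (3/2 * Q * sqrt m) ^ (3 * N))" using E \<open>1 \<le> Q\<close> by simp
  qed
  finally show ?thesis by (simp add: HK E_def Q_def mult.assoc)
qed

end

section \<open>Transfer to the given random vectors\<close>

lemma sorted_wrt_fst_less_unique:
  fixes xs ys :: "('a::linorder \<times> 'b) list"
  assumes xs: "sorted_wrt (\<lambda>p q. fst p < fst q) xs" and ys: "sorted_wrt (\<lambda>p q. fst p < fst q) ys"
    and eq: "set xs = set ys"
  shows "xs = ys"
  using assms
proof (induction xs arbitrary: ys)
  case (Cons x xs)
  then obtain y ys' where ys: "ys = y # ys'" by (cases ys) auto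
  have "x = y"
  proof (rule ccontr)
    assume "x \<noteq> y"
    then have "y \<in> set xs" "x \<in> set ys'" using Cons.prems(3) ys by auto
    then show False using Cons.prems(1,2) ys by fastforce
  qed
  have "x \<notin> set xs" "y \<notin> set ys'" using Cons.prems(1,2) ys by auto
  then have "set xs = set ys'" using Cons.prems(3) ys \<open>x = y\<close> by auto
  then show ?case using Cons.IH[of ys'] Cons.prems(1,2) ys \<open>x = y\<close> by auto
qed simp

lemma inj_on_set_multiidx: "inj_on set (multiidx m)"
  by (rule inj_onI) (auto simp: multiidx_def intro: sorted_wrt_fst_less_unique)

lemma multiidx_distinct_fst:
  assumes "\<alpha> \<in> multiidx m"
  shows "distinct (map fst \<alpha>)"
proof -
  have "sorted_wrt (<) (map fst \<alpha>)" using assms by (simp add: multiidx_def sorted_wrt_map)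
  then show ?thesis by (simp add: strict_sorted_iff)
qed

lemma xpow_eq_prod:
  assumes "\<alpha> \<in> multiidx m"
  shows "xpow x \<alpha> = (\<Prod>p\<in>set \<alpha>. x (fst p) (snd p))"
  using multiidx_distinct_fst[OF assms]
  by (simp add: xpow_def case_prod_beta' prod.distinct_set_conv_list distinct_map)

lemma SN_eq_mlpoly:
  "SN m N c x = mlpoly {\<alpha>\<in>multiidx m. length \<alpha> \<le> N \<and> c \<alpha> \<noteq> 0} c set x"
  unfolding SN_def mlpoly_def by (intro sum.cong) (auto simp: xpow_eq_prod)

lemma admissible_multiidx:
  assumes "finite {\<alpha>. c \<alpha> \<noteq> 0}"
  obtains K where "0 < K" "admissible {..<K} m {\<alpha>\<in>multiidx m. length \<alpha> \<le> N \<and> c \<alpha> \<noteq> (0::real)} set"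
proof -
  let ?J = "{\<alpha>\<in>multiidx m. length \<alpha> \<le> N \<and> c \<alpha> \<noteq> 0}"
  have fin: "finite ?J" by (rule finite_subset[OF _ assms]) auto
  then have "finite (\<Union>\<alpha>\<in>?J. fst ` set \<alpha>)" by auto
  then obtain K where K: "\<And>n. n \<in> (\<Union>\<alpha>\<in>?J. fst ` set \<alpha>) \<Longrightarrow> n < K"
    unfolding finite_nat_set_iff_bounded by auto
  show ?thesis
  proof
    \<comment> \<open>A positive bound is needed because the product characterisation of
      independence asks for a nonempty index set.\<close>
    show "0 < Suc K" by simp
    have "inj_on set ?J" using inj_on_set_multiidx by (rule inj_on_subset) auto
    moreover have "set \<alpha> \<subseteq> {..<Suc K} \<times> {1..m}" "inj_on fst (set \<alpha>)" if \<alpha>: "\<alpha> \<in> ?J" for \<alpha>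
    proof
      fix p assume p: "p \<in> set \<alpha>"
      then have "fst p < K" using K[of "fst p"] \<alpha> by blast
      moreover have "snd p \<in> {1..m}" using p \<alpha> by (simp add: multiidx_def)
      ultimately show "p \<in> {..<Suc K} \<times> {1..m}" by (cases p) auto
    next
      show "inj_on fst (set \<alpha>)" using multiidx_distinct_fst[of \<alpha> m] \<alpha> by (simp add: distinct_map)
    qed
    ultimately show "admissible {..<Suc K} m ?J set" using fin by (auto simp: admissible_def)
  qed
qed

section \<open>Joint laws of the given blocks\<close>

definition block_law :: "'a measure \<Rightarrow> nat \<Rightarrow> (nat \<Rightarrow> 'a \<Rightarrow> real) \<Rightarrow> (nat \<Rightarrow> real) measure" where
  "block_law M m X = distr M (PiM {1..m} (\<lambda>_. borel)) (\<lambda>\<omega>. restrict (\<lambda>i. X i \<omega>) {1..m})"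

lemma measurable_block:
  assumes "\<And>i. i \<in> {1..m} \<Longrightarrow> X i \<in> borel_measurable M"
  shows "(\<lambda>\<omega>. restrict (\<lambda>i. X i \<omega>) {1..m}) \<in> measurable M (PiM {1..m} (\<lambda>_. borel))"
  by (rule measurable_restrict) (rule assms)

lemma integral_block_law:
  fixes g :: "(nat \<Rightarrow> real) \<Rightarrow> real"
  assumes "\<And>i. i \<in> {1..m} \<Longrightarrow> X i \<in> borel_measurable M" "g \<in> borel_measurable (PiM {1..m} (\<lambda>_. borel))"
  shows "(\<integral>z. g z \<partial>block_law M m X) = (\<integral>\<omega>. g (restrict (\<lambda>i. X i \<omega>) {1..m}) \<partial>M)"
    and "integrable (block_law M m X) g \<longleftrightarrow> integrable M (\<lambda>\<omega>. g (restrict (\<lambda>i. X i \<omega>) {1..m}))"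
  unfolding block_law_def
  by (rule integral_distr[OF measurable_block[OF assms(1)] assms(2)] integrable_distr_eq[OF measurable_block[OF assms(1)] assms(2)]; assumption)+

lemma cube_int_powr_thirdI:
  assumes "g \<in> borel_measurable M" "0 \<le> Q" "integrable M (\<lambda>\<omega>. \<bar>g \<omega>\<bar> ^ 3)"
    and le: "(\<integral>\<omega>. \<bar>g \<omega>\<bar> ^ 3 \<partial>M) powr (1/3) \<le> Q"
  shows "cube_int M g Q"
proof -
  let ?I = "\<integral>\<omega>. \<bar>g \<omega>\<bar> ^ 3 \<partial>M"
  have "?I = (?I powr (1/3)) powr 3" by (simp add: powr_powr)
  also have "\<dots> = (?I powr (1/3)) ^ 3" by (rule powr_numeral) simp
  also have "\<dots> \<le> Q ^ 3" using le by (intro power_mono) auto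
  finally show ?thesis using assms by (simp add: cube_int_def)
qed

lemma moment_law_block:
  assumes PM: "prob_space M" and X: "\<And>i. i \<in> {1..m} \<Longrightarrow> X i \<in> borel_measurable M"
    and Q: "1 \<le> Q"
    and cent: "\<And>i. i \<in> {1..m} \<Longrightarrow> (\<integral>\<omega>. X i \<omega> \<partial>M) = 0"
    and L3: "\<And>i. i \<in> {1..m} \<Longrightarrow> integrable M (\<lambda>\<omega>. \<bar>X i \<omega>\<bar> ^ 3) \<and> (\<integral>\<omega>. \<bar>X i \<omega>\<bar> ^ 3 \<partial>M) powr (1/3) \<le> Q"
  shows "moment_law m Q (block_law M m X)"
proof -
  have comp: "(\<lambda>z. z i) \<in> borel_measurable (PiM {1..m} (\<lambda>_. borel :: real measure))" if "i \<in> {1..m}" for i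
    using that by (rule measurable_component_singleton)
  have "cube_int (block_law M m X) (\<lambda>z. z i) Q \<and> (\<integral>z. z i \<partial>block_law M m X) = 0" if i: "i \<in> {1..m}" for i
  proof -
    have c3: "(\<lambda>z. \<bar>z i\<bar> ^ 3) \<in> borel_measurable (PiM {1..m} (\<lambda>_. borel :: real measure))"
      using comp[OF i] by measurable
    have c: "cube_int M (X i) Q"
      using L3[OF i] Q by (intro cube_int_powr_thirdI X i) auto
    have "(\<lambda>z. z i) \<in> borel_measurable (block_law M m X)"
      using comp[OF i] by (simp add: block_law_def)
    then show ?thesis
      using integral_block_law[OF X c3] integral_block_law(1)[OF X comp[OF i]] i c cent[OF i]
      by (simp add: cube_int_def)
  qed
  moreover have "prob_space (block_law M m X)"
    unfolding block_law_def by (rule prob_space.prob_space_distr[OF PM measurable_block[OF X]])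
  ultimately show ?thesis using Q by (simp add: moment_law_def)
qed

text \<open>Only finitely many blocks occur in the polynomial, and by independence their joint law
  is the product of the block laws.\<close>

lemma integral_mlpoly_indep:
  fixes X :: "nat \<Rightarrow> nat \<Rightarrow> 'a \<Rightarrow> real" and h :: "real \<Rightarrow> real"
  assumes PM: "prob_space M" and X: "\<And>n i. i \<in> {1..m} \<Longrightarrow> X n i \<in> borel_measurable M"
    and indep: "prob_space.indep_vars M (\<lambda>_. PiM {1..m} (\<lambda>_. borel)) (\<lambda>n \<omega>. restrict (\<lambda>i. X n i \<omega>) {1..m}) UNIV"
    and K: "0 < K" and A: "admissible {..<K} m J A" and h: "h \<in> borel_measurable borel"
    and law: "\<And>n. moment_law m Q (block_law M m (X n))"
  shows "(\<integral>\<omega>. h (mlpoly J a A (\<lambda>n i. X n i \<omega>)) \<partial>M) = (\<integral>x. h (mlpoly J a A x) \<partial>PiM {..<K} (\<lambda>n. block_law M m (X n)))"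
proof -
  interpret prob_space M by fact
  let ?B = "PiM {1..m} (\<lambda>_. borel :: real measure)"
  let ?Y = "\<lambda>n \<omega>. restrict (\<lambda>i. X n i \<omega>) {1..m}"
  have Y: "?Y n \<in> measurable M ?B" for n by (rule measurable_block[OF X])
  have "indep_vars (\<lambda>_. ?B) ?Y {..<K}" by (rule indep_vars_subset[OF indep]) simp
  then have distr: "distr M (PiM {..<K} (\<lambda>_. ?B)) (\<lambda>\<omega>. \<lambda>n\<in>{..<K}. ?Y n \<omega>) = PiM {..<K} (\<lambda>n. block_law M m (X n))"
    using K Y unfolding block_law_def by (subst (asm) indep_vars_iff_distr_eq_PiM) auto
  have sets: "sets (PiM {..<K} (\<lambda>n. block_law M m (X n))) = sets (PiM {..<K} (\<lambda>_. ?B))"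
    unfolding block_law_def by (intro sets_PiM_cong) auto
  have "mlpoly J a A \<in> borel_measurable (PiM {..<K} (\<lambda>_. ?B))"
    using mlpoly_measurable[where \<mu>="\<lambda>n. block_law M m (X n)", OF law A] by (simp only: measurable_cong_sets[OF sets refl])
  then have meas: "(\<lambda>x. h (mlpoly J a A x)) \<in> borel_measurable (PiM {..<K} (\<lambda>_. ?B))"
    using h by (rule measurable_compose)
  have "(\<integral>x. h (mlpoly J a A x) \<partial>PiM {..<K} (\<lambda>n. block_law M m (X n)))
    = (\<integral>\<omega>. h (mlpoly J a A (\<lambda>n\<in>{..<K}. ?Y n \<omega>)) \<partial>M)"
    unfolding distr[symmetric] by (rule integral_distr[OF _ meas]) (intro measurable_restrict Y)
  also have "\<dots> = (\<integral>\<omega>. h (mlpoly J a A (\<lambda>n i. X n i \<omega>)) \<partial>M)"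
  proof -
    have "mlpoly J a A (\<lambda>n\<in>{..<K}. ?Y n \<omega>) = mlpoly J a A (\<lambda>n i. X n i \<omega>)" for \<omega>
      unfolding mlpoly_def
    proof (intro sum.cong refl arg_cong2[where f="(*)"] prod.cong)
      fix j p assume "j \<in> J" "p \<in> A j"
      then have "p \<in> {..<K} \<times> {1..m}" using A by (auto simp: admissible_def)
      then show "(\<lambda>n\<in>{..<K}. ?Y n \<omega>) (fst p) (snd p) = X (fst p) (snd p) \<omega>" by auto
    qed
    then show ?thesis by simp
  qed
  finally show ?thesis by simp
qed

section \<open>Norms, influence and the arithmetic of constants\<close>

lemma Cb3_abs_le_norm3:
  assumes f: "Cb3 f" and k: "k \<le> 3"
  shows "\<bar>(deriv ^^ k) f x\<bar> \<le> norm3 f"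
proof -
  have "bounded (range ((deriv ^^ k) f))" using f k by (simp add: Cb3_def)
  then obtain B where "\<And>x. \<bar>(deriv ^^ k) f x\<bar> \<le> B" by (auto simp: bounded_iff)
  then have "bdd_above (range (\<lambda>x. \<bar>(deriv ^^ k) f x\<bar>))" by (rule bdd_aboveI2)
  then have "\<bar>(deriv ^^ k) f x\<bar> \<le> (SUP x. \<bar>(deriv ^^ k) f x\<bar>)" by (rule cSUP_upper[rotated]) simp
  also have "\<dots> \<le> norm3 f" unfolding norm3_def using k by (intro Max_ge) auto
  finally show ?thesis .
qed

text \<open>Finite support keeps the sums bounded, without which the real supremum would carry no
  information. \<open>influence\<close> admits multi-indices of every length, so it dominates the
  sums truncated at N.\<close>

lemma influence_bounds:
  fixes c :: "(nat \<times> nat) list \<Rightarrow> real"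
  assumes fin: "finite {\<alpha>. c \<alpha> \<noteq> 0}"
  shows "0 \<le> influence m c"
    and "(\<Sum>\<alpha> | \<alpha> \<in> {\<alpha>\<in>multiidx m. length \<alpha> \<le> N \<and> c \<alpha> \<noteq> 0} \<and> k \<in> fst ` set \<alpha>. (c \<alpha>)\<^sup>2) \<le> (influence m c)\<^sup>2"
proof -
  define s where "s n = (\<Sum>\<alpha>\<in>{\<alpha>\<in>multiidx m. n \<in> fst ` set \<alpha> \<and> c \<alpha> \<noteq> 0}. (c \<alpha>)\<^sup>2)" for n
  have "s n \<le> (\<Sum>\<alpha> | c \<alpha> \<noteq> 0. (c \<alpha>)\<^sup>2)" for n
    unfolding s_def using fin by (intro sum_mono2) auto
  then have "bdd_above (range s)" by (auto intro!: bdd_aboveI)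
  then have sup: "s n \<le> (SUP n. s n)" for n by (rule cSUP_upper[rotated]) simp
  have s0: "0 \<le> s n" for n unfolding s_def by (intro sum_nonneg) auto
  have infl: "influence m c = sqrt (SUP n. s n)" by (simp add: influence_def s_def)
  have S0: "0 \<le> (SUP n. s n)" using sup[of 0] s0[of 0] by linarith
  then show "0 \<le> influence m c" by (simp add: infl)
  have "(\<Sum>\<alpha> | \<alpha> \<in> {\<alpha>\<in>multiidx m. length \<alpha> \<le> N \<and> c \<alpha> \<noteq> 0} \<and> k \<in> fst ` set \<alpha>. (c \<alpha>)\<^sup>2) \<le> s k"
    unfolding s_def by (intro sum_mono2 finite_subset[OF _ fin]) auto
  also have "\<dots> \<le> (influence m c)\<^sup>2" using sup[of k] S0 by (simp add: infl)
  finally show "(\<Sum>\<alpha> | \<alpha> \<in> {\<alpha>\<in>multiidx m. length \<alpha> \<le> N \<and> c \<alpha> \<noteq> 0} \<and> k \<in> fst ` set \<alpha>. (c \<alpha>)\<^sup>2) \<le> (influence m c)\<^sup>2" .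
qed

text \<open>The telescoping sum costs a factor N, which is absorbed by the gap between
  (3/2)^3 = 27/8 and the lower bound 29/8 for the cube of the Burkholder constant.\<close>

lemma Suc_mult_power_le:
  fixes B :: real
  assumes B: "29/8 \<le> B"
  shows "real (Suc n) * (27/8) ^ n \<le> 4 * B ^ Suc n"
proof -
  \<comment> \<open>Here 29/27 = 1 + 2/27, and 4 * (27/8) * (2/27) = 1, so that Bernoulli's
    inequality yields the factor \<open>Suc n\<close> with coefficient exactly 1.\<close>
  have "1 + real (Suc n) * (2/27) \<le> (1 + 2/27) ^ Suc n"
    by (rule Bernoulli_inequality) simp
  then have "4 * (27/8) ^ Suc n * (1 + real (Suc n) * (2/27)) \<le> 4 * (27/8) ^ Suc n * (1 + 2/27) ^ Suc n"
    by (intro mult_left_mono) auto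
  also have "\<dots> = 4 * (29/8 :: real) ^ Suc n"
    by (simp only: mult.assoc power_mult_distrib[symmetric]) simp
  also have "\<dots> \<le> 4 * B ^ Suc n" using B by (intro mult_left_mono power_mono) auto
  finally have "4 * (27/8) ^ Suc n * (1 + real (Suc n) * (2/27)) \<le> 4 * B ^ Suc n" .
  moreover have "4 * (27/8) ^ Suc n * (1 + real (Suc n) * (2/27)) = (27/2 + real (Suc n)) * (27/8) ^ n"
    by (simp add: field_simps)
  moreover have "real (Suc n) * (27/8) ^ n \<le> (27/2 + real (Suc n)) * (27/8) ^ n"
    by (intro mult_right_mono) auto
  ultimately show ?thesis by linarith
qed

text \<open>The exponents differ by 3: the extra (sqrt m * Q)^3 on the right absorbs sqrt m ^ 3, the
  extra b ^ 3 serves \<open>Suc_mult_power_le\<close>, and its factor 4 is the quotient of 2/3 by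
  1/6.\<close>

lemma lindeberg_constant_le:
  fixes b Q :: real and m n :: nat
  assumes b: "29/8 \<le> b ^ 3" and Q: "1 \<le> Q" and m: "1 \<le> m"
  shows "sqrt m ^ 3 * (3/2 * Q * sqrt m) ^ (3 * n) * Suc n / 6 \<le> 2 * m / 3 * (b * sqrt m * Q) ^ (3 * Suc n)"
proof -
  define R where "R = (sqrt m * Q) ^ 3"
  have sm: "1 \<le> sqrt m" using m by simp
  have R0: "0 \<le> R" using Q by (simp add: R_def)
  have b0: "0 \<le> b ^ 3" using b by linarith
  have "sqrt m ^ 3 \<le> R" unfolding R_def using Q sm by (intro power_mono) auto
  have e1: "(3/2 * Q * sqrt m) ^ (3 * n) = (27/8) ^ n * R ^ n"
  proof -
    have "(3/2 * Q * sqrt m) ^ 3 = 27/8 * R"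
      unfolding R_def by (simp add: power_mult_distrib power_divide)
    then show ?thesis by (simp only: power_mult power_mult_distrib)
  qed
  have e2: "(b * sqrt m * Q) ^ (3 * Suc n) = (b ^ 3) ^ Suc n * R ^ Suc n"
    unfolding R_def power_mult by (simp only: power_mult_distrib mult.assoc)
  have "sqrt m ^ 3 * (3/2 * Q * sqrt m) ^ (3 * n) * Suc n / 6 \<le> R * ((27/8) ^ n * R ^ n) * Suc n / 6"
    unfolding e1 using \<open>sqrt m ^ 3 \<le> R\<close> R0 by (intro divide_right_mono mult_right_mono) auto
  also have "\<dots> = (Suc n * (27/8) ^ n) * R ^ Suc n / 6" by simp
  also have "\<dots> \<le> (4 * (b ^ 3) ^ Suc n) * R ^ Suc n / 6"
    using R0 by (intro divide_right_mono mult_right_mono Suc_mult_power_le b) auto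
  also have "\<dots> = 2 * 1 / 3 * ((b ^ 3) ^ Suc n * R ^ Suc n)" by simp
  also have "\<dots> \<le> 2 * m / 3 * ((b ^ 3) ^ Suc n * R ^ Suc n)"
    using m b R0 by (intro mult_right_mono divide_right_mono mult_left_mono mult_nonneg_nonneg
      zero_le_power[OF b0] zero_le_power[OF R0]) auto
  finally show ?thesis unfolding e2 .
qed

lemma SN_measurable:
  assumes "\<And>n i. i \<in> {1..m} \<Longrightarrow> X n i \<in> borel_measurable M"
  shows "(\<lambda>\<omega>. SN m N c (\<lambda>n i. X n i \<omega>)) \<in> borel_measurable M"
  unfolding SN_eq_mlpoly mlpoly_def
proof (intro borel_measurable_sum borel_measurable_times borel_measurable_prod borel_measurable_const)
  fix \<alpha> p assume "\<alpha> \<in> {\<alpha>\<in>multiidx m. length \<alpha> \<le> N \<and> c \<alpha> \<noteq> 0}" "p \<in> set \<alpha>"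
  then show "(\<lambda>\<omega>. X (fst p) (snd p) \<omega>) \<in> borel_measurable M"
    by (intro assms) (auto simp: multiidx_def)
qed

lemma (in prob_space) integral_eq_const_AE:
  fixes g :: "'a \<Rightarrow> real"
  assumes "g \<in> borel_measurable M" "AE \<omega> in M. g \<omega> = y"
  shows "(\<integral>\<omega>. g \<omega> \<partial>M) = y"
  using integral_cong_AE[OF assms(1) borel_measurable_const assms(2)] by (simp add: prob_space)

lemma centred_gaussian_vec_component:
  assumes X: "centred_gaussian_vec M I X" and I: "finite I" and i: "i \<in> I"
  shows "(AE \<omega> in M. X i \<omega> = 0) \<or> (\<exists>\<sigma>>0. distributed M lborel (X i) (normal_density 0 \<sigma>))"
proof -
  \<comment> \<open>The indicator of i is the coefficient vector that singles out one
    component.\<close>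
  have eq: "(\<Sum>k\<in>I. (if k = i then 1 else 0) * X k \<omega>) = X i \<omega>" for \<omega>
    using I i by (simp add: if_distrib[of "\<lambda>z. z * _"] cong: if_cong)
  have "(AE \<omega> in M. (\<Sum>k\<in>I. (if k = i then 1 else 0) * X k \<omega>) = 0) \<or>
      (\<exists>\<sigma>>0. distributed M lborel (\<lambda>\<omega>. \<Sum>k\<in>I. (if k = i then 1 else 0) * X k \<omega>) (normal_density 0 \<sigma>))"
    using X unfolding centred_gaussian_vec_def by (elim conjE allE)
  then show ?thesis unfolding eq .
qed

theorem theorem2p2:
  fixes M :: "'a measure" and M' :: "'b measure"
    and Z :: "nat \<Rightarrow> nat \<Rightarrow> 'a \<Rightarrow> real" and G :: "nat \<Rightarrow> nat \<Rightarrow> 'b \<Rightarrow> real"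
    and m N :: nat and M3Z M3G b3 :: real
    and c :: "(nat \<times> nat) list \<Rightarrow> real" and f :: "real \<Rightarrow> real"
  assumes PM: "prob_space M" and PM': "prob_space M'"
    and b3: "b3 \<ge> 1" "burkholder3 M b3" "burkholder3 M' b3"
    and Zmeas: "\<And>n i. i \<in> {1..m} \<Longrightarrow> Z n i \<in> borel_measurable M"
    and Zindep: "prob_space.indep_vars M (\<lambda>_. PiM {1..m} (\<lambda>_. borel))
                   (\<lambda>n \<omega>. restrict (\<lambda>i. Z n i \<omega>) {1..m}) UNIV"
    and Zcent: "\<And>n i. i \<in> {1..m} \<Longrightarrow> integrable M (Z n i) \<and> (\<integral>\<omega>. Z n i \<omega> \<partial>M) = 0"
    and M3Z: "M3Z \<ge> 1"
    and ZL3: "\<And>n i. i \<in> {1..m} \<Longrightarrow> integrable M (\<lambda>\<omega>. \<bar>Z n i \<omega>\<bar> ^ 3) \<and>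
                 (\<integral>\<omega>. \<bar>Z n i \<omega>\<bar> ^ 3 \<partial>M) powr (1/3) \<le> M3Z"
    and Ggauss: "\<And>n. centred_gaussian_vec M' {1..m} (G n)"
    and Gindep: "prob_space.indep_vars M' (\<lambda>_. PiM {1..m} (\<lambda>_. borel))
                   (\<lambda>n \<omega>. restrict (\<lambda>i. G n i \<omega>) {1..m}) UNIV"
    and Gcov: "\<And>n i j. i \<in> {1..m} \<Longrightarrow> j \<in> {1..m} \<Longrightarrow>
                 (\<integral>\<omega>. G n i \<omega> * G n j \<omega> \<partial>M') = (\<integral>\<omega>. Z n i \<omega> * Z n j \<omega> \<partial>M)"
    and M3G: "M3G \<ge> 1"
    and GL3: "\<And>n i. i \<in> {1..m} \<Longrightarrow> integrable M' (\<lambda>\<omega>. \<bar>G n i \<omega>\<bar> ^ 3) \<and>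
                 (\<integral>\<omega>. \<bar>G n i \<omega>\<bar> ^ 3 \<partial>M') powr (1/3) \<le> M3G"
    and cfin: "finite {\<alpha>. c \<alpha> \<noteq> 0}"
    and f: "Cb3 f"
  shows "\<bar>(\<integral>\<omega>. f (SN m N c (\<lambda>n i. Z n i \<omega>)) \<partial>M) - (\<integral>\<omega>. f (SN m N c (\<lambda>n i. G n i \<omega>)) \<partial>M')\<bar>
    \<le> (2 * real m / 3) * (M3Z ^ 3 + M3G ^ 3) * (b3 * sqrt (real m) * max M3Z M3G) ^ (3 * N)
       * norm3 f * coeff_norm_sq m N c * influence m c"
    (is "\<bar>?EZ - ?EG\<bar> \<le> ?bound")
proof -
  interpret MZ: prob_space M by fact
  interpret MG: prob_space M' by fact
  define J where "J = {\<alpha>\<in>multiidx m. length \<alpha> \<le> N \<and> c \<alpha> \<noteq> 0}"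
  define Q where "Q = max M3Z M3G"
  have Q: "1 \<le> Q" using M3Z by (simp add: Q_def)
  have SN: "SN m N c x = mlpoly J c set x" for x by (simp add: SN_eq_mlpoly J_def)
  have norm: "coeff_norm_sq m N c = (\<Sum>\<alpha>\<in>J. (c \<alpha>)\<^sup>2)" by (simp add: coeff_norm_sq_def J_def)
  have f3: "\<bar>(deriv ^^ 3) f x\<bar> \<le> norm3 f" and f0: "\<bar>f x\<bar> \<le> norm3 f" for x
    using Cb3_abs_le_norm3[OF f, of 3 x] Cb3_abs_le_norm3[OF f, of 0 x] by simp_all
  have nonneg: "0 \<le> norm3 f" "0 \<le> coeff_norm_sq m N c" "0 \<le> influence m c"
    using f0[of 0] influence_bounds(1)[OF cfin] by (simp_all add: norm sum_nonneg)
  have bound0: "0 \<le> ?bound"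
    using nonneg b3(1) M3Z M3G by (intro mult_nonneg_nonneg add_nonneg_nonneg zero_le_power) auto
  interpret bounded_smooth3 "\<lambda>k. (deriv ^^ k) f" "norm3 f" "norm3 f"
    using f f3 f0 by unfold_locales (simp_all add: Cb3_def)
  have Gmeas: "G n i \<in> borel_measurable M'" if "i \<in> {1..m}" for n i
    using Ggauss[of n] that by (simp add: centred_gaussian_vec_def)
  define h0 where "h0 = f (SN m N c (\<lambda>_ _. 0))"
  have const: "?bound \<ge> \<bar>?EZ - ?EG\<bar>" if "?EZ = h0" "?EG = h0"
    using that bound0 by simp
  show ?thesis
  \<comment> \<open>Only the empty multi-index can occur here, so both expectations are the same
    constant. Otherwise N = n + 1, with n the degree of the partial derivatives, and m >= 1 makes
    the weight per variable at least 1.\<close>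
  proof (cases "m = 0 \<or> N = 0")
    case True
    then have nil: "\<alpha> = []" if "\<alpha> \<in> J" for \<alpha>
      using that by (cases \<alpha>) (auto simp: J_def multiidx_def)
    then have "SN m N c x = SN m N c (\<lambda>_ _. 0)" for x
      unfolding SN mlpoly_def using nil by (intro sum.cong refl) fastforce
    then have "f (SN m N c x) = h0" for x unfolding h0_def by (rule arg_cong[where f=f])
    then have "?EZ = h0" "?EG = h0" by (simp_all add: MZ.prob_space MG.prob_space)
    then show ?thesis by (rule const)
  next
    case False
    then obtain n where m: "1 \<le> m" and N: "N = Suc n" by (cases N) auto
    obtain K where K: "0 < K" and A: "admissible {..<K} m J set"
      by (rule admissible_multiidx[OF cfin, of m N, folded J_def])
    let ?\<mu> = "\<lambda>n. block_law M m (Z n)" and ?\<nu> = "\<lambda>n. block_law M' m (G n)"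
    have Gcent: "(\<integral>\<omega>. G n i \<omega> \<partial>M') = 0" if i: "i \<in> {1..m}" for n i
    proof -
      from centred_gaussian_vec_component[OF Ggauss _ i, of n]
      consider "AE \<omega> in M'. G n i \<omega> = 0" | \<sigma> where "0 < \<sigma>" "distributed M' lborel (G n i) (normal_density 0 \<sigma>)"
        by auto
      then show ?thesis
      proof cases
        case 1 then show ?thesis by (rule integral_eq_zero_AE)
      next
        case 2 then show ?thesis using MG.normal_distributed_expectation by blast
      qed
    qed
    have \<mu>: "moment_law m M3Z (?\<mu> n)" for n
      using Zcent ZL3 by (intro moment_law_block PM Zmeas M3Z) auto
    have \<nu>: "moment_law m M3G (?\<nu> n)" for n
      using GL3 by (intro moment_law_block PM' Gmeas M3G Gcent) auto
    have EZ: "?EZ = (\<integral>x. f (mlpoly J c set x) \<partial>PiM {..<K} ?\<mu>)"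
      unfolding SN using measurable_fd0 by (intro integral_mlpoly_indep[OF PM Zmeas Zindep K A _ \<mu>]) auto
    have EG: "?EG = (\<integral>x. f (mlpoly J c set x) \<partial>PiM {..<K} ?\<nu>)"
      unfolding SN using measurable_fd0 by (intro integral_mlpoly_indep[OF PM' Gmeas Gindep K A _ \<nu>]) auto
    have cov: "(\<integral>z. z i * z j \<partial>?\<mu> n) = (\<integral>z. z i * z j \<partial>?\<nu> n)" if ij: "i \<in> {1..m}" "j \<in> {1..m}" for n i j
    proof -
      have [measurable]: "(\<lambda>z. z k) \<in> borel_measurable (PiM {1..m} (\<lambda>_. borel :: real measure))" if "k \<in> {1..m}" for k
        using that by (rule measurable_component_singleton)
      have "(\<lambda>z. z i * z j) \<in> borel_measurable (PiM {1..m} (\<lambda>_. borel :: real measure))"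
        using ij by measurable
      from integral_block_law(1)[OF Zmeas this] integral_block_law(1)[OF Gmeas this]
      show ?thesis using ij Gcov[of i j n] by simp
    qed
    show ?thesis
    \<comment> \<open>A component that does not vanish is normal with positive variance; its density
      on \<open>M'\<close> is what the lower bound for \<open>b3\<close> requires.\<close>
    proof (cases "\<exists>n. \<exists>i\<in>{1..m}. \<not> (AE \<omega> in M'. G n i \<omega> = 0)")
      case True
      then obtain n' i where i: "i \<in> {1..m}" and ne: "\<not> (AE \<omega> in M'. G n' i \<omega> = 0)" by auto
      then obtain \<sigma> where "distributed M' lborel (G n' i) (normal_density 0 \<sigma>)"
        using centred_gaussian_vec_component[OF Ggauss _ i, of n'] by auto
      then have b: "29/8 \<le> b3 ^ 3" using PM' b3(3) burkholder3_lower_bound by blast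
      have card: "card (set \<alpha>) \<le> Suc n" if "\<alpha> \<in> J" for \<alpha>
        using that card_length[of \<alpha>] N by (auto simp: J_def)
      have "\<bar>?EZ - ?EG\<bar> \<le> norm3 f / 6 * (M3Z ^ 3 + M3G ^ 3) * (sqrt m ^ 3 * (3/2 * Q * sqrt m) ^ (3 * n))
          * (Suc n * (\<Sum>\<alpha>\<in>J. (c \<alpha>)\<^sup>2) * influence m c)"
        using lindeberg_product[OF \<mu> \<nu> cov A card M3Z M3G m influence_bounds(1)[OF cfin]]
          influence_bounds(2)[OF cfin, of m N]
        unfolding EZ EG Q_def J_def by simp
      also have "\<dots> = norm3 f * (M3Z ^ 3 + M3G ^ 3) * coeff_norm_sq m N c * influence m c
          * (sqrt m ^ 3 * (3/2 * Q * sqrt m) ^ (3 * n) * Suc n / 6)"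
        by (simp add: norm)
      also have "\<dots> \<le> norm3 f * (M3Z ^ 3 + M3G ^ 3) * coeff_norm_sq m N c * influence m c
          * (2 * m / 3 * (b3 * sqrt m * Q) ^ (3 * Suc n))"
        using nonneg M3Z M3G by (intro mult_left_mono lindeberg_constant_le[OF b Q m] mult_nonneg_nonneg) auto
      finally show ?thesis unfolding N Q_def by (simp only: mult_ac)
    next
      case False
      then have G0: "AE \<omega> in M'. G n i \<omega> = 0" if "i \<in> {1..m}" for n i using that by auto
      \<comment> \<open>Equal second moments carry the vanishing over from G to Z. Integrability of
        the square is established first, because a zero integral alone would not suffice.\<close>
      have Z0: "AE \<omega> in M. Z n i \<omega> = 0" if i: "i \<in> {1..m}" for n i
      proof -
        have c: "cube_int M (Z n i) M3Z"
          using ZL3[OF i, of n] M3Z by (intro cube_int_powr_thirdI Zmeas i) auto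
        have "integrable M (\<lambda>\<omega>. Z n i \<omega> * Z n i \<omega>)"
          using MZ.cube_int_imp_square(1)[OF c] M3Z by (simp add: power2_eq_square)
        moreover have "(\<integral>\<omega>. Z n i \<omega> * Z n i \<omega> \<partial>M) = 0"
          unfolding Gcov[OF i i, symmetric] using G0[OF i] by (intro integral_eq_zero_AE) auto
        ultimately show ?thesis
          by (subst (asm) integral_nonneg_eq_0_iff_AE) auto
      qed
      have SN0: "SN m N c x = SN m N c (\<lambda>_ _. 0)" if "\<And>n i. i \<in> {1..m} \<Longrightarrow> x n i = 0" for x
      proof -
        have "(\<Prod>p\<in>set \<alpha>. x (fst p) (snd p)) = (\<Prod>p\<in>set \<alpha>. 0)" if "\<alpha> \<in> J" for \<alpha>
          using that \<open>\<And>n i. i \<in> {1..m} \<Longrightarrow> x n i = 0\<close> by (intro prod.cong) (auto simp: J_def multiidx_def)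
        then show ?thesis unfolding SN mlpoly_def by (intro sum.cong) auto
      qed
      have "AE \<omega> in M. \<forall>n. \<forall>i\<in>{1..m}. Z n i \<omega> = 0"
        using Z0 by (simp add: AE_all_countable AE_ball_countable)
      then have "AE \<omega> in M. f (SN m N c (\<lambda>n i. Z n i \<omega>)) = h0"
        by eventually_elim (auto simp: h0_def intro!: arg_cong[where f=f] SN0)
      moreover have "AE \<omega> in M'. \<forall>n. \<forall>i\<in>{1..m}. G n i \<omega> = 0"
        using G0 by (simp add: AE_all_countable AE_ball_countable)
      then have "AE \<omega> in M'. f (SN m N c (\<lambda>n i. G n i \<omega>)) = h0"
        by eventually_elim (auto simp: h0_def intro!: arg_cong[where f=f] SN0)
      ultimately have "?EZ = h0" "?EG = h0"
        using SN_measurable[OF Zmeas] SN_measurable[OF Gmeas] measurable_fd0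
        by (auto intro!: MZ.integral_eq_const_AE MG.integral_eq_const_AE)
      then show ?thesis by (rule const)
    qed
  qed
qed

end
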